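(* Let $(\mathfrak g,g,J)$ be a $2n$-dimensional almost Hermitian two-step solvable Lie algebra with totally real $m$-dimensional commutator ideal $\mathfrak g'$, and set $U_J:=(\mathfrak g'\oplus J\mathfrak g')^{\perp}$. Then $(\mathfrak g,g,J)$ is SKT if and only if there exist an orthonormal basis $(X_1,\dots,X_m)$ of $\mathfrak g'$, some $r\in\{0,\dots,m\}$, $\lambda_1,\dots,\lambda_r\in\mathbb R\setminus\{0\}$, $\mu_1,\dots,\mu_r\in U_J^*$ and two-forms $\tilde\nu_{r+1},\dots,\tilde\nu_m\in\Lambda^2U_J^*$ such that the only non-zero Lie brackets (up to anti-symmetry) are given by $$[JX_i,X_i]=\lambda_iX_i,\quad [Y,X_i]=\mu_i(Y)X_i,\quad [Y,JX_i]=-\mu_i(JY)X_i,$$ $$[Y,Z]=\sum_{i=1}^r\frac1{\lambda_i}(\mu_i\wedge\mu_i\circ J)(Y,Z)X_i+\sum_{j=r+1}^m\tilde\nu_j(Y,Z)X_j$$ for $i=1,\dots,r$ and $Y,Z\in U_J$, and such that, for $\tilde\nu:=\sum_{i=r+1}^m\tilde\nu_iX_i$, we have $\sum_{i=r+1}^m\tilde\nu_i\wedge\tilde\nu_i=0$ and $\operatorname{im}(\tilde\nu)=\operatorname{span}(X_{r+1},\dots,X_m)$. If this is the case, then $\mathfrak g\cong r\,\mathfrak{aff}_{\mathbb R}\oplus\mathfrak h$ for some $2(n-r)$-dimensional nilpotent Lie algebra $\mathfrak h$.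
   Context: An almost Hermitian Lie algebra $(\mathfrak g,g,J)$ is a finite-dimensional real Lie algebra with an inner product $g$ and an endomorphism $J$, $J^2=-\mathrm{id}$, with $g(J\cdot,J\cdot)=g$; put $\sigma=g(J\cdot,\cdot)$. It is SKT if $J$ is integrable ($[JX,JY]-J[JX,Y]-J[X,JY]-[X,Y]=0$) and $d(J^*d\sigma)=0$, where $d$ is the Chevalley–Eilenberg differential and $(J^*\beta)(X_1,\dots,X_k)=\beta(JX_1,\dots,JX_k)$. $\mathfrak g'=[\mathfrak g,\mathfrak g]$; two-step solvable means $\mathfrak g'$ is Abelian; $\mathfrak g'$ is totally real if $\mathfrak g'\cap J\mathfrak g'=\{0\}$. Wedge convention: $(\alpha\wedge\beta)(Y,Z)=\alpha(Y)\beta(Z)-\alpha(Z)\beta(Y)$ for one-forms. $\operatorname{im}(\tilde\nu)$ denotes the image of the linear map $\Lambda^2U_J\to\mathfrak g'$ defined by $\tilde\nu$. $\mathfrak{aff}_{\mathbb R}$ is the two-dimensional non-Abelian Lie algebra and $r\,\mathfrak{aff}_{\mathbb R}$ the direct sum of $r$ copies.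
   Formalization: The two-forms ν̃_j are additionally required to be of type (1,1), i.e. ν̃_j(JY,JZ)=ν̃_j(Y,Z) on U_J; without this the "if" direction fails, e.g. for the single bracket [e1,e3]=X with e2=Je1, e4=Je3, where J is not integrable. *)

theory Defs
  imports "HOL-Analysis.Analysis" "HOL-Library.Function_Algebras"
begin

text \<open>
  Lie algebras are given by a carrier, which is a linear subspace of some real vector space,
  and a bracket that is only meaningful on the carrier. In this way the zero Lie algebra and
  direct sums of a variable number of copies are available.
\<close>

instantiation "fun" :: (type, real_vector) real_vector
begin

definition scaleR_fun_def: "scaleR c f = (\<lambda>x. c *\<^sub>R f x)"

instance
  by standard (auto simp: scaleR_fun_def fun_eq_iff algebra_simps)

end

definition linear_on :: "'a::real_vector set \<Rightarrow> ('a \<Rightarrow> 'b::real_vector) \<Rightarrow> bool" where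
  "linear_on V f \<longleftrightarrow>
     (\<forall>x\<in>V. \<forall>y\<in>V. f (x + y) = f x + f y) \<and> (\<forall>c. \<forall>x\<in>V. f (c *\<^sub>R x) = c *\<^sub>R f x)"

definition bilinear_on ::
    "'a::real_vector set \<Rightarrow> ('a \<Rightarrow> 'a \<Rightarrow> 'b::real_vector) \<Rightarrow> bool" where
  "bilinear_on V b \<longleftrightarrow>
     (\<forall>x\<in>V. linear_on V (\<lambda>y. b x y)) \<and> (\<forall>y\<in>V. linear_on V (\<lambda>x. b x y))"

definition lie_algebra :: "'a::real_vector set \<Rightarrow> ('a \<Rightarrow> 'a \<Rightarrow> 'a) \<Rightarrow> bool" where
  "lie_algebra L b \<longleftrightarrow>
     subspace L \<and> (\<forall>x\<in>L. \<forall>y\<in>L. b x y \<in> L) \<and> bilinear_on L b \<and>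
     (\<forall>x\<in>L. b x x = 0) \<and>
     (\<forall>x\<in>L. \<forall>y\<in>L. \<forall>z\<in>L. b x (b y z) + b y (b z x) + b z (b x y) = 0)"

definition lie_isomorphic ::
    "'a::real_vector set \<Rightarrow> ('a \<Rightarrow> 'a \<Rightarrow> 'a) \<Rightarrow> 'b::real_vector set \<Rightarrow> ('b \<Rightarrow> 'b \<Rightarrow> 'b) \<Rightarrow> bool" where
  "lie_isomorphic L b M c \<longleftrightarrow>
     (\<exists>f. linear_on L f \<and> bij_betw f L M \<and> (\<forall>x\<in>L. \<forall>y\<in>L. f (b x y) = c (f x) (f y)))"

definition commutator :: "'a::real_vector set \<Rightarrow> ('a \<Rightarrow> 'a \<Rightarrow> 'a) \<Rightarrow> 'a set" where
  "commutator L b = span {b x y |x y. x \<in> L \<and> y \<in> L}"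

definition two_step_solvable :: "'a::real_vector set \<Rightarrow> ('a \<Rightarrow> 'a \<Rightarrow> 'a) \<Rightarrow> bool" where
  "two_step_solvable L b \<longleftrightarrow> (\<forall>x\<in>commutator L b. \<forall>y\<in>commutator L b. b x y = 0)"

primrec lower_central ::
    "'a::real_vector set \<Rightarrow> ('a \<Rightarrow> 'a \<Rightarrow> 'a) \<Rightarrow> nat \<Rightarrow> 'a set" where
  "lower_central L b 0 = L"
| "lower_central L b (Suc k) = span {b x y |x y. x \<in> L \<and> y \<in> lower_central L b k}"

definition nilpotent_lie :: "'a::real_vector set \<Rightarrow> ('a \<Rightarrow> 'a \<Rightarrow> 'a) \<Rightarrow> bool" where
  "nilpotent_lie L b \<longleftrightarrow> (\<exists>k. lower_central L b k = {0})"

text \<open>The Lie algebra \<open>aff\<close> is \<open>\<real>\<^sup>2\<close> with \<open>[e\<^sub>1, e\<^sub>2] = e\<^sub>2\<close>.\<close>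

definition aff_bracket :: "real \<times> real \<Rightarrow> real \<times> real \<Rightarrow> real \<times> real" where
  "aff_bracket x y = (0, fst x * snd y - snd x * fst y)"

definition copies_carrier :: "nat \<Rightarrow> 'a::real_vector set \<Rightarrow> (nat \<Rightarrow> 'a) set" where
  "copies_carrier r L = {f. (\<forall>i<r. f i \<in> L) \<and> (\<forall>i\<ge>r. f i = 0)}"

definition copies_bracket ::
    "('a \<Rightarrow> 'a \<Rightarrow> 'a) \<Rightarrow> (nat \<Rightarrow> 'a) \<Rightarrow> (nat \<Rightarrow> 'a) \<Rightarrow> nat \<Rightarrow> 'a" where
  "copies_bracket b f h = (\<lambda>i. b (f i) (h i))"

definition sum_bracket ::
    "('a \<Rightarrow> 'a \<Rightarrow> 'a) \<Rightarrow> ('b \<Rightarrow> 'b \<Rightarrow> 'b) \<Rightarrow> 'a \<times> 'b \<Rightarrow> 'a \<times> 'b \<Rightarrow> 'a \<times> 'b" where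
  "sum_bracket b c x y = (b (fst x) (fst y), c (snd x) (snd y))"


text \<open>
  In the almost Hermitian setting the Lie algebra is a whole Euclidean space and the metric
  \<open>g\<close> is its inner product.
\<close>

definition almost_hermitian ::
    "('a::euclidean_space \<Rightarrow> 'a \<Rightarrow> 'a) \<Rightarrow> ('a \<Rightarrow> 'a) \<Rightarrow> bool" where
  "almost_hermitian br J \<longleftrightarrow>
     lie_algebra UNIV br \<and> linear J \<and> (\<forall>x. J (J x) = - x) \<and> (\<forall>x y. J x \<bullet> J y = x \<bullet> y)"

definition integrable_J :: "('a::real_vector \<Rightarrow> 'a \<Rightarrow> 'a) \<Rightarrow> ('a \<Rightarrow> 'a) \<Rightarrow> bool" where
  "integrable_J br J \<longleftrightarrow>
     (\<forall>x y. br (J x) (J y) - J (br (J x) y) - J (br x (J y)) - br x y = 0)"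

text \<open>
  A \<open>k\<close>-form is represented by a function on argument lists, of which only the values on lists
  of length \<open>k\<close> matter. The Chevalley--Eilenberg differential is
  \<open>d\<alpha>(x\<^sub>0, \<dots>, x\<^sub>k) = \<Sum>\<^bsub>i<j\<^esub> (-1)\<^bsup>i+j\<^esup> \<alpha>([x\<^sub>i, x\<^sub>j], x\<^sub>0, \<dots>, x\<^sub>k)\<close>, with \<open>x\<^sub>i\<close> and \<open>x\<^sub>j\<close>
  omitted from the list after the bracket.
\<close>

definition ce_diff ::
    "('a \<Rightarrow> 'a \<Rightarrow> 'a) \<Rightarrow> ('a list \<Rightarrow> real) \<Rightarrow> 'a list \<Rightarrow> real" where
  "ce_diff br \<alpha> xs =
     (\<Sum>j<length xs. \<Sum>i<j. (-1) ^ (i + j) * \<alpha> (br (xs ! i) (xs ! j) # nths xs (- {i, j})))"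

definition pull_J :: "('a \<Rightarrow> 'a) \<Rightarrow> ('a list \<Rightarrow> real) \<Rightarrow> 'a list \<Rightarrow> real" where
  "pull_J J \<beta> xs = \<beta> (map J xs)"

definition fundamental_form :: "('a::real_inner \<Rightarrow> 'a) \<Rightarrow> 'a list \<Rightarrow> real" where
  "fundamental_form J xs = J (xs ! 0) \<bullet> (xs ! 1)"

definition SKT :: "('a::real_inner \<Rightarrow> 'a \<Rightarrow> 'a) \<Rightarrow> ('a \<Rightarrow> 'a) \<Rightarrow> bool" where
  "SKT br J \<longleftrightarrow>
     integrable_J br J \<and>
     (\<forall>xs. length xs = 4 \<longrightarrow>
        ce_diff br (pull_J J (ce_diff br (fundamental_form J))) xs = 0)"

definition U_space :: "('a::real_inner \<Rightarrow> 'a \<Rightarrow> 'a) \<Rightarrow> ('a \<Rightarrow> 'a) \<Rightarrow> 'a set" where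
  "U_space br J =
     orthogonal_comp {x + J y |x y. x \<in> commutator UNIV br \<and> y \<in> commutator UNIV br}"

definition two_form_on :: "'a::real_vector set \<Rightarrow> ('a \<Rightarrow> 'a \<Rightarrow> real) \<Rightarrow> bool" where
  "two_form_on U \<nu> \<longleftrightarrow> bilinear_on U \<nu> \<and> (\<forall>x\<in>U. \<nu> x x = 0)"

definition type_11_on ::
    "'a set \<Rightarrow> ('a \<Rightarrow> 'a) \<Rightarrow> ('a \<Rightarrow> 'a \<Rightarrow> real) \<Rightarrow> bool" where
  "type_11_on U J \<nu> \<longleftrightarrow> (\<forall>x\<in>U. \<forall>y\<in>U. \<nu> (J x) (J y) = \<nu> x y)"

definition wedge11 :: "('a \<Rightarrow> real) \<Rightarrow> ('a \<Rightarrow> real) \<Rightarrow> 'a \<Rightarrow> 'a \<Rightarrow> real" where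
  "wedge11 \<alpha> \<beta> y z = \<alpha> y * \<beta> z - \<alpha> z * \<beta> y"

text \<open>Sum over the \<open>(2,2)\<close>-shuffles, matching the convention of \<open>wedge11\<close>.\<close>

definition wedge22 ::
    "('a \<Rightarrow> 'a \<Rightarrow> real) \<Rightarrow> ('a \<Rightarrow> 'a \<Rightarrow> real) \<Rightarrow> 'a \<Rightarrow> 'a \<Rightarrow> 'a \<Rightarrow> 'a \<Rightarrow> real" where
  "wedge22 \<alpha> \<beta> w x y z =
     \<alpha> w x * \<beta> y z - \<alpha> w y * \<beta> x z + \<alpha> w z * \<beta> x y
     + \<alpha> x y * \<beta> w z - \<alpha> x z * \<beta> w y + \<alpha> y z * \<beta> w x"

text \<open>
  The image of the linear map on \<open>\<Lambda>\<^sup>2U\<close> induced by an alternating bilinear map \<open>\<nu>\<close> on \<open>U\<close>: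
  \<open>\<Lambda>\<^sup>2U\<close> is spanned by the elements \<open>y \<and> z\<close>, and these are sent to \<open>\<nu> y z\<close>.
\<close>

definition Lambda2_image :: "'a set \<Rightarrow> ('a \<Rightarrow> 'a \<Rightarrow> 'b::real_vector) \<Rightarrow> 'b set" where
  "Lambda2_image U \<nu> = span {\<nu> y z |y z. y \<in> U \<and> z \<in> U}"

text \<open>
  The Lie algebra is spanned by the \<open>X\<^sub>i\<close>, the \<open>J X\<^sub>i\<close> and \<open>U\<close>, so the brackets between these
  determine the bracket. Those that are not among the four families given first are required to
  vanish. Indices run from \<open>1\<close>.
\<close>

definition brackets_given_by ::
    "('a::real_inner \<Rightarrow> 'a \<Rightarrow> 'a) \<Rightarrow> ('a \<Rightarrow> 'a) \<Rightarrow> nat \<Rightarrow> (nat \<Rightarrow> 'a) \<Rightarrow> nat \<Rightarrow>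
     (nat \<Rightarrow> real) \<Rightarrow> (nat \<Rightarrow> 'a \<Rightarrow> real) \<Rightarrow> (nat \<Rightarrow> 'a \<Rightarrow> 'a \<Rightarrow> real) \<Rightarrow> bool" where
  "brackets_given_by br J m X r lam \<mu> \<nu> \<longleftrightarrow>
     (\<forall>i\<in>{1..r}. br (J (X i)) (X i) = lam i *\<^sub>R X i) \<and>
     (\<forall>i\<in>{1..r}. \<forall>y\<in>U_space br J. br y (X i) = \<mu> i y *\<^sub>R X i) \<and>
     (\<forall>i\<in>{1..r}. \<forall>y\<in>U_space br J. br y (J (X i)) = - \<mu> i (J y) *\<^sub>R X i) \<and>
     (\<forall>y\<in>U_space br J. \<forall>z\<in>U_space br J.
        br y z = (\<Sum>i=1..r. (1 / lam i * wedge11 (\<mu> i) (\<mu> i \<circ> J) y z) *\<^sub>R X i)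
               + (\<Sum>j=r+1..m. \<nu> j y z *\<^sub>R X j)) \<and>
     (\<forall>i\<in>{1..m}. \<forall>j\<in>{1..m}. br (X i) (X j) = 0) \<and>
     (\<forall>i\<in>{1..m}. \<forall>j\<in>{1..m}. br (J (X i)) (J (X j)) = 0) \<and>
     (\<forall>i\<in>{1..m}. \<forall>j\<in>{1..m}. i \<noteq> j \<or> r < i \<longrightarrow> br (J (X i)) (X j) = 0) \<and>
     (\<forall>i\<in>{r+1..m}. \<forall>y\<in>U_space br J. br y (X i) = 0 \<and> br y (J (X i)) = 0)"

text \<open>
  The forms \<open>\<nu> j\<close> are required to be of type \<open>(1,1)\<close>. This is exactly what integrability of
  \<open>J\<close> says about them, and the remaining conditions do not imply it: on \<open>\<real>\<^sup>6\<close> with orthonormal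
  basis \<open>X, JX, e\<^sub>1, e\<^sub>2 = J e\<^sub>1, e\<^sub>3, e\<^sub>4 = J e\<^sub>3\<close> and only non-zero bracket \<open>[e\<^sub>1, e\<^sub>3] = X\<close> all
  other conditions hold with \<open>r = 0\<close>, but \<open>J\<close> is not integrable.
\<close>

definition SKT_data ::
    "('a::real_inner \<Rightarrow> 'a \<Rightarrow> 'a) \<Rightarrow> ('a \<Rightarrow> 'a) \<Rightarrow> nat \<Rightarrow> (nat \<Rightarrow> 'a) \<Rightarrow> nat \<Rightarrow>
     (nat \<Rightarrow> real) \<Rightarrow> (nat \<Rightarrow> 'a \<Rightarrow> real) \<Rightarrow> (nat \<Rightarrow> 'a \<Rightarrow> 'a \<Rightarrow> real) \<Rightarrow> bool" where
  "SKT_data br J m X r lam \<mu> \<nu> \<longleftrightarrow>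
     (\<forall>i\<in>{1..m}. \<forall>j\<in>{1..m}. X i \<bullet> X j = (if i = j then 1 else 0)) \<and>
     span (X ` {1..m}) = commutator UNIV br \<and>
     r \<le> m \<and>
     (\<forall>i\<in>{1..r}. lam i \<noteq> 0) \<and>
     (\<forall>i\<in>{1..r}. linear_on (U_space br J) (\<mu> i)) \<and>
     (\<forall>j\<in>{r+1..m}. two_form_on (U_space br J) (\<nu> j)) \<and>
     (\<forall>j\<in>{r+1..m}. type_11_on (U_space br J) J (\<nu> j)) \<and>
     brackets_given_by br J m X r lam \<mu> \<nu> \<and>
     (\<forall>w\<in>U_space br J. \<forall>x\<in>U_space br J. \<forall>y\<in>U_space br J. \<forall>z\<in>U_space br J.
        (\<Sum>j=r+1..m. wedge22 (\<nu> j) (\<nu> j) w x y z) = 0) \<and>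
     Lambda2_image (U_space br J) (\<lambda>y z. \<Sum>j=r+1..m. \<nu> j y z *\<^sub>R X j) = span (X ` {r+1..m})"

end

theory Submission
  imports Defs
begin

text \<open>
  Since \<open>\<gg>'\<close> is totally real, integrability means \<open>[JX, JY] = [X, Y]\<close>, and then the torsion form
  \<open>J\<^sup>*d\<sigma>\<close> is, up to sign, the cyclic sum of \<open>g([X, Y], Z)\<close>. By the Jacobi identity it is closed iff
  \<open>g([W, X], [Y, Z]) - g([W, Y], [X, Z]) + g([W, Z], [X, Y]) = 0\<close>.

  The product \<open>A \<cdot> B = [JA, B]\<close> makes \<open>\<gg>'\<close> a commutative associative algebra commuting with all
  \<open>ad Y\<close>. The closedness condition gives \<open>g([JY, Y], A \<cdot> A) = |[Y, A]|\<^sup>2 + |[JY, A]|\<^sup>2\<close>, so elements of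
  square zero are central, and the vectors \<open>[JY, Y]\<close> span \<open>\<gg>'\<close>, which forces \<open>A \<cdot> A = 0\<close> whenever
  the square of \<open>A \<cdot> A\<close> vanishes. Hence a minimal ideal with nonzero product is a line: it is unital,
  its multiplications are symmetric, and it has no zero divisors. The generators of these lines are
  pairwise orthogonal, each spans a line preserved by all \<open>ad Y\<close>, and their orthogonal complement
  in \<open>\<gg>'\<close> is central.
\<close>

section \<open>The torsion form\<close>

locale two_step_hermitian =
  fixes br :: "'a::euclidean_space \<Rightarrow> 'a \<Rightarrow> 'a" and J :: "'a \<Rightarrow> 'a"
  assumes almost_hermitian: "almost_hermitian br J"
    and two_step: "two_step_solvable UNIV br"
begin

abbreviation G :: "'a set" where "G \<equiv> commutator UNIV br"

lemma linear_J: "linear J" and J_J [simp]: "J (J x) = - x" and inner_J: "J x \<bullet> J y = x \<bullet> y"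
  using almost_hermitian by (auto simp: almost_hermitian_def)

lemmas J_simps = linear_add[OF linear_J] linear_diff[OF linear_J] linear_neg[OF linear_J]
  linear_scale[OF linear_J] linear_0[OF linear_J]

lemma inner_J_right: "x \<bullet> J y = - (J x \<bullet> y)"
  using inner_J[of x "J y"] by simp

lemma bilinear_br: "bilinear br"
  using almost_hermitian
  by (auto simp: almost_hermitian_def lie_algebra_def bilinear_on_def linear_on_def bilinear_def
      intro!: linearI)

lemmas br_simps = bilinear_ladd[OF bilinear_br] bilinear_radd[OF bilinear_br]
  bilinear_lsub[OF bilinear_br] bilinear_rsub[OF bilinear_br]
  bilinear_lneg[OF bilinear_br] bilinear_rneg[OF bilinear_br]
  bilinear_lmul[OF bilinear_br] bilinear_rmul[OF bilinear_br]
  bilinear_lzero[OF bilinear_br] bilinear_rzero[OF bilinear_br]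

lemma linear_br_left: "linear (\<lambda>x. br x y)" and linear_br_right: "linear (br x)"
  using bilinear_br by (auto simp: bilinear_def)

lemma br_self [simp]: "br x x = 0"
  using almost_hermitian by (auto simp: almost_hermitian_def lie_algebra_def)

lemma br_skew: "br x y = - br y x"
  using br_self[of "x + y"] by (simp add: br_simps eq_neg_iff_add_eq_0 del: br_self)
    (simp add: add.commute)

lemma jacobi: "br x (br y z) + br y (br z x) + br z (br x y) = 0"
  using almost_hermitian by (auto simp: almost_hermitian_def lie_algebra_def)

lemma subspace_G: "subspace G"
  by (simp add: commutator_def)

lemma br_in_G [simp]: "br x y \<in> G"
  by (auto simp: commutator_def intro: span_base)

lemma br_G_G: "A \<in> G \<Longrightarrow> B \<in> G \<Longrightarrow> br A B = 0"
  using two_step by (auto simp: two_step_solvable_def)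

text \<open>This is the Jacobi identity; its third term is the bracket of \<open>A\<close> with a
  commutator, which vanishes because \<open>G\<close> is Abelian.\<close>

lemma ad_commute: "br x (br y A) = br y (br x A)" if "A \<in> G"
proof -
  have "br A (br x y) = 0" using that by (simp add: br_G_G)
  then show ?thesis
    using jacobi[of x y A] br_skew[of A x] by (simp add: br_simps eq_neg_iff_add_eq_0)
qed

text \<open>Polarization: invariance of the bracket under \<open>J\<close> makes
  \<open>br (J u) y\<close> symmetric in \<open>u\<close> and \<open>y\<close>, so its squares
  determine it. The choice \<open>u = - J x\<close> turns \<open>br (J u) y\<close> into
  \<open>br x y\<close>.\<close>

lemma G_subset_span_squares:
  assumes ab: "\<And>x y. br (J x) (J y) = br x y"
  shows "G \<subseteq> span (range (\<lambda>x. br (J x) x))" (is "_ \<subseteq> span ?N")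
proof -
  have "br x y \<in> span ?N" for x y
  proof -
    define u where "u = - J x"
    have Ju: "J u = x" by (simp add: u_def J_simps)
    have "br (J y) u = br (J u) y"
      using ab[of y "J u"] br_skew[of y "J u"] by (simp add: br_simps)
    then have "br (J (u + y)) (u + y) - br (J u) u - br (J y) y = 2 *\<^sub>R br x y"
      by (simp add: br_simps J_simps Ju scaleR_2)
    moreover have "br (J (u + y)) (u + y) - br (J u) u - br (J y) y \<in> span ?N"
      by (intro span_diff span_base) auto
    ultimately show ?thesis using span_scale[of "2 *\<^sub>R br x y" ?N "1/2"] by simp
  qed
  then show ?thesis unfolding commutator_def by (intro span_minimal) auto
qed

text \<open>The Nijenhuis equation equates an element of \<open>G\<close> with an element of
  \<open>J\<close> applied to \<open>G\<close>; if \<open>G\<close> is totally real, both vanish.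
  Conversely, invariance lets \<open>J\<close> move from one argument to the other with a sign, and
  the four terms cancel in pairs.\<close>

lemma integrable_J_iff:
  assumes "G \<inter> J ` G = {0}"
  shows "integrable_J br J \<longleftrightarrow> (\<forall>x y. br (J x) (J y) = br x y)"
proof
  assume int: "integrable_J br J"
  show "\<forall>x y. br (J x) (J y) = br x y"
  proof (intro allI)
    fix x y
    have "br (J x) (J y) - br x y = J (br (J x) y + br x (J y))"
      using int by (simp add: integrable_J_def J_simps algebra_simps)
    moreover have "br (J x) (J y) - br x y \<in> G" "br (J x) y + br x (J y) \<in> G"
      by (simp_all add: subspace_G subspace_diff subspace_add)
    ultimately have "br (J x) (J y) - br x y \<in> G \<inter> J ` G" by auto
    then show "br (J x) (J y) = br x y" using assms by simp
  qed
next
  assume ab: "\<forall>x y. br (J x) (J y) = br x y"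
  have "br (J x) y = - br x (J y)" for x y
    using ab[rule_format, of x "J y"] by (simp add: br_simps) (metis add.inverse_inverse)
  with ab show "integrable_J br J" by (simp add: integrable_J_def J_simps)
qed

end

section \<open>The differential in degrees two and three, and the closedness of the torsion
  form\<close>

lemma ce_diff_2form:
  "ce_diff br \<alpha> [x, y, z] = - \<alpha> [br x y, z] + \<alpha> [br x z, y] - \<alpha> [br y z, x]"
  by (simp add: ce_diff_def numeral_eq_Suc nths_Cons)

lemma ce_diff_3form:
  "ce_diff br \<alpha> [w, x, y, z] =
     - \<alpha> [br w x, y, z] + \<alpha> [br w y, x, z] - \<alpha> [br x y, w, z]
     - \<alpha> [br w z, x, y] + \<alpha> [br x z, w, y] - \<alpha> [br y z, w, x]"
  by (simp add: ce_diff_def numeral_eq_Suc nths_Cons)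

context two_step_hermitian
begin

lemma torsion_form:
  assumes ab: "\<And>x y. br (J x) (J y) = br x y"
  shows "pull_J J (ce_diff br (fundamental_form J)) [x, y, z] =
    - (br x y \<bullet> z) + br x z \<bullet> y - br y z \<bullet> x"
  by (simp add: pull_J_def ce_diff_2form fundamental_form_def ab inner_J)

text \<open>For an Abelian complex structure, \<open>J\<close> drops out of the torsion form, and in its differential
  the terms with iterated brackets cancel by the Jacobi identity.\<close>

lemma SKT_iff:
  assumes "G \<inter> J ` G = {0}"
  shows "SKT br J \<longleftrightarrow> (\<forall>x y. br (J x) (J y) = br x y) \<and>
    (\<forall>w x y z. br w x \<bullet> br y z - br w y \<bullet> br x z + br w z \<bullet> br x y = 0)"
proof (cases "\<forall>x y. br (J x) (J y) = br x y")
  case False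
  then show ?thesis using integrable_J_iff[OF assms] unfolding SKT_def by blast
next
  case ab: True
  have iter: "br (br w x) y - br (br w y) x + br (br x y) w = 0" for w x y
    using jacobi[of w x y] br_skew[of "br w x" y] br_skew[of "br w y" x] br_skew[of "br x y" w]
      br_skew[of y w]
    by (simp add: br_simps algebra_simps)
  have "ce_diff br (pull_J J (ce_diff br (fundamental_form J))) [w, x, y, z] =
      2 * (br w x \<bullet> br y z - br w y \<bullet> br x z + br w z \<bullet> br x y)" for w x y z
  proof -
    \<comment> \<open>Each of the four arguments in turn is paired with the Jacobi identity of the
      other three.\<close>
    have "(br (br w x) y - br (br w y) x + br (br x y) w) \<bullet> z = 0"
      "(br (br w x) z - br (br w z) x + br (br x z) w) \<bullet> y = 0"
      "(br (br w y) z - br (br w z) y + br (br y z) w) \<bullet> x = 0"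
      "(br (br x y) z - br (br x z) y + br (br y z) x) \<bullet> w = 0"
      by (simp_all only: iter inner_zero_left)
    then show ?thesis
      by (simp add: ce_diff_3form torsion_form ab inner_simps inner_commute)
  qed
  moreover have "(\<forall>xs. length xs = 4 \<longrightarrow> Q xs) \<longleftrightarrow> (\<forall>w x y z. Q [w, x, y, z])"
    for Q :: "'a list \<Rightarrow> bool"
    by (auto simp: numeral_eq_Suc length_Suc_conv)
  ultimately show ?thesis
    using ab integrable_J_iff[OF assms] unfolding SKT_def
    by (simp del: right_diff_distrib_numeral distrib_left_numeral)
qed

end

section \<open>The commutative algebra on the commutator ideal\<close>

locale abelian_complex = two_step_hermitian +
  assumes br_J_J: "br (J x) (J y) = br x y"
begin

lemma br_J_left: "br (J x) y = - br x (J y)"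
  using br_J_J[of x "J y"] by (simp add: br_simps) (metis add.inverse_inverse)

text \<open>Commutativity of the product \<open>br (J A) B\<close>; it holds on the whole space,
  which allows mixed products of elements of \<open>G\<close> with arbitrary vectors.\<close>

lemma mult_commute: "br (J A) B = br (J B) A"
  using br_J_left[of A B] br_skew[of A "J B"] by simp

text \<open>Jacobi for \<open>J A\<close>, \<open>x\<close>, \<open>y\<close>, with \<open>J\<close>
  moved off \<open>A\<close>. The action of \<open>A\<close> on a commutator is thus known once the
  operators \<open>br x\<close> are known on \<open>A\<close>.\<close>

lemma mult_br: "br (J A) (br x y) = br x (br (J y) A) - br y (br (J x) A)"
proof -
  have 1: "br y (J A) = - br (J y) A" "br (J A) x = br (J x) A"
    using br_J_left[of y A] mult_commute[of A x] by simp_all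
  show ?thesis using jacobi[of "J A" x y] unfolding 1
    by (simp add: br_simps algebra_simps eq_neg_iff_add_eq_0)
qed

text \<open>For a commutative product, associativity amounts to multiplications commuting with each
  other, which is \<open>ad_commute\<close>.\<close>

lemma mult_assoc: "br (J A) (br (J B) C) = br (J (br (J A) B)) C" if "B \<in> G"
  using ad_commute[OF that, of "J A" "J C"] mult_commute[of B C] mult_commute[of "br (J A) B" C]
  by simp

end

section \<open>Positivity from the pluriclosed condition\<close>

locale abelian_skt = abelian_complex +
  assumes pluriclosed: "br w x \<bullet> br y z - br w y \<bullet> br x z + br w z \<bullet> br x y = 0"
begin

text \<open>In the pluriclosed identity for \<open>J A\<close>, \<open>B\<close>,
  \<open>J C\<close>, \<open>D\<close> the middle term contains \<open>br B D = 0\<close>. With a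
  unit in place of \<open>C\<close> this becomes symmetry of the multiplication by
  \<open>A\<close>.\<close>

lemma inner_mult_swap: "br (J A) B \<bullet> br (J C) D = br (J A) D \<bullet> br (J C) B"
  if "A \<in> G" "B \<in> G" "C \<in> G" "D \<in> G"
  using pluriclosed[of "J A" B "J C" D] that br_skew[of B "J C"]
  by (simp add: br_J_J br_G_G)

text \<open>The pluriclosed identity at \<open>x\<close>, \<open>J x\<close>, \<open>J A\<close>,
  \<open>B\<close>. For \<open>A = B\<close> the right side is a sum of two squared norms, which is
  why elements of square zero are central.\<close>

lemma inner_square_mult:
  "br (J x) x \<bullet> br (J A) B = br x A \<bullet> br x B + br (J x) A \<bullet> br (J x) B"
  using pluriclosed[of x "J x" "J A" B] br_skew[of x "J x"] br_J_left[of x A]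
  by (simp add: br_J_J inner_commute)

lemma mult_square: "br (J A) (br (J x) x) = br x (br x A) + br (J x) (br (J x) A)"
  using mult_br[of A "J x" x] by (simp add: br_simps)

lemma br_eq_0_if_square_eq_0: "br x A = 0" if "br (J A) A = 0"
  using inner_square_mult[of x A A] that
  by (simp add: add_nonneg_eq_0_iff)

text \<open>The square \<open>?C\<close> of \<open>A\<close> is central because its own square is
  zero. The square of \<open>br x A\<close> is \<open>br x (br x ?C) = 0\<close>, so
  \<open>br x A\<close> is central as well. By \<open>mult_square\<close>, \<open>A\<close> then
  annihilates all \<open>br (J x) x\<close>, and these span a space containing
  \<open>A\<close>.\<close>

lemma square_eq_0_if_fourth_power_eq_0:
  assumes A: "A \<in> G" and C0: "br (J (br (J A) A)) (br (J A) A) = 0"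
  shows "br (J A) A = 0"
proof -
  let ?C = "br (J A) A"
  note central = br_eq_0_if_square_eq_0
  have D2: "br y (br x A) = 0" for x y
  proof (rule central)
    have "br (J (br x A)) (br x A) = br x (br (J A) (br x A))"
      using ad_commute[OF A] mult_commute[of A "br x A"] by simp
    also have "\<dots> = br x (br x ?C)" using ad_commute[OF A] by simp
    also have "\<dots> = 0" using central[OF C0] by (simp add: br_simps)
    finally show "br (J (br x A)) (br x A) = 0" .
  qed
  have "A \<in> span (range (\<lambda>x. br (J x) x))"
    using A G_subset_span_squares[OF br_J_J] by blast
  moreover have "br (J A) b = 0" if "b \<in> range (\<lambda>x. br (J x) x)" for b
    using that D2 by (auto simp: mult_square)
  ultimately show ?thesis using linear_eq_0_on_span[OF linear_br_right] by blast
qed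

end

text \<open>The quadratic form of \<open>f\<close> attains a maximum \<open>t\<close> on the unit
  sphere of \<open>I\<close>, and a maximizer is an eigenvector for \<open>t\<close>.\<close>

lemma symmetric_operator_eigenvector:
  fixes f :: "'a::euclidean_space \<Rightarrow> 'a"
  assumes "linear f" and I: "subspace I" "I \<noteq> {0}" and inv: "\<And>x. x \<in> I \<Longrightarrow> f x \<in> I"
    and sym: "\<And>x y. x \<in> I \<Longrightarrow> y \<in> I \<Longrightarrow> f x \<bullet> y = x \<bullet> f y"
  obtains t c where "c \<in> I" "c \<noteq> 0" "f c = t *\<^sub>R c"
proof -
  interpret linear f by fact
  let ?S = "I \<inter> sphere 0 1"
  obtain a where a: "a \<in> I" "a \<noteq> 0" using I subspace_0 by blast
  have "compact ?S" by (simp add: closed_Int_compact closed_subspace I)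
  moreover have "(1 / norm a) *\<^sub>R a \<in> ?S" using a I by (simp add: subspace_scale)
  moreover have "continuous_on ?S (\<lambda>x. f x \<bullet> x)"
    by (intro continuous_intros linear_continuous_on linear_conv_bounded_linear[THEN iffD1]) fact
  ultimately obtain c where c: "c \<in> ?S" and max: "\<And>x. x \<in> ?S \<Longrightarrow> f x \<bullet> x \<le> f c \<bullet> c"
    using continuous_attains_sup[of ?S "\<lambda>x. f x \<bullet> x"] by blast
  define t where "t = f c \<bullet> c"
  have cI: "c \<in> I" and cc: "c \<bullet> c = 1" using c by (auto simp: dot_square_norm)
  have le: "f x \<bullet> x \<le> t * (x \<bullet> x)" if "x \<in> I" for x
  proof (cases "x = 0")
    case False
    then have "(1 / norm x) *\<^sub>R x \<in> ?S" using that I by (simp add: subspace_scale)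
    from max[OF this] have "(f x \<bullet> x) / (norm x * norm x) \<le> t"
      by (simp add: t_def scale)
    then show ?thesis using False by (simp add: divide_le_eq dot_square_norm power2_eq_square)
  qed (simp add: zero)
  \<comment> \<open>\<open>t - f\<close> is positive semidefinite and isotropic at \<open>c\<close>, so \<open>c\<close> is in its kernel.\<close>
  define u where "u = t *\<^sub>R c - f c"
  have uI: "u \<in> I" using cI I inv by (simp add: u_def subspace_diff subspace_scale)
  define q where "q = t * (u \<bullet> u) - f u \<bullet> u"
  have "0 \<le> 2 * s * (u \<bullet> u) + s\<^sup>2 * q" for s
  proof -
    have "c + s *\<^sub>R u \<in> I" using cI uI I by (simp add: subspace_add subspace_scale)
    note le[OF this]
    also have "f (c + s *\<^sub>R u) \<bullet> (c + s *\<^sub>R u) = t + 2 * s * (f c \<bullet> u) + s\<^sup>2 * (f u \<bullet> u)"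
      using sym[OF cI uI] inner_commute[of "f u" c]
      by (simp add: add scale inner_add_left inner_add_right t_def power2_eq_square distrib_left)
    also have "(c + s *\<^sub>R u) \<bullet> (c + s *\<^sub>R u) = 1 + 2 * s * (c \<bullet> u) + s\<^sup>2 * (u \<bullet> u)"
      using cc inner_commute[of u c]
      by (simp add: inner_add_left inner_add_right power2_eq_square distrib_left)
    finally have "0 \<le> 2 * s * (t * (c \<bullet> u) - f c \<bullet> u) + s\<^sup>2 * q"
      by (simp add: q_def algebra_simps)
    moreover have "u \<bullet> u = t * (c \<bullet> u) - f c \<bullet> u"
      by (subst (1) u_def) (simp add: inner_diff_left)
    ultimately show ?thesis by simp
  qed
  note quad = this
  have "u \<bullet> u \<le> 0"
  proof (rule ccontr)
    assume "\<not> u \<bullet> u \<le> 0"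
    then have pos: "u \<bullet> u > 0" by linarith
    \<comment> \<open>A negative step so short that the quadratic term cannot outweigh the linear
      one; the summand 1 covers \<open>q = 0\<close>.\<close>
    define s where "s = - (u \<bullet> u) / (\<bar>q\<bar> + 1)"
    have "s < 0" using pos by (simp add: s_def divide_neg_pos add_nonneg_pos)
    have "s * q \<le> \<bar>s\<bar> * \<bar>q\<bar>" by (metis abs_mult abs_ge_self)
    have "s * q \<ge> - (\<bar>s\<bar> * \<bar>q\<bar>)" by (metis abs_mult abs_ge_minus_self minus_le_iff)
    moreover have "\<bar>s\<bar> * \<bar>q\<bar> \<le> u \<bullet> u"
      by (simp add: s_def abs_divide divide_le_eq mult_left_mono)
    ultimately have "2 * (u \<bullet> u) + s * q > 0" using pos by linarith
    then have "s * (2 * (u \<bullet> u) + s * q) < 0" using \<open>s < 0\<close> by (simp add: mult_neg_pos)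
    then show False using quad[of s] by (simp add: power2_eq_square algebra_simps)
  qed
  then have "u = 0" by (metis inner_eq_zero_iff inner_ge_zero order_antisym)
  then have "f c = t *\<^sub>R c" by (simp add: u_def)
  moreover have "c \<noteq> 0" using cc by auto
  ultimately show thesis using that cI by blast
qed

section \<open>Ideals of the product and the axes they contain\<close>

context abelian_skt
begin

text \<open>Ideals of the commutative algebra \<open>G\<close>, not of the Lie algebra: only the
  multiplications by elements of \<open>G\<close> have to preserve \<open>I\<close>.\<close>

definition ideal :: "'a set \<Rightarrow> bool" where
  "ideal I \<longleftrightarrow> subspace I \<and> I \<subseteq> G \<and> (\<forall>A\<in>I. \<forall>B\<in>G. br (J B) A \<in> I)"

text \<open>If \<open>c\<close> in \<open>I\<close> has non-zero square, then the multiples of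
  \<open>c\<close> by \<open>I\<close> form an ideal inside \<open>I\<close>. It contains the square
  of \<open>c\<close>, whose square is again non-zero, so by minimality multiplication by
  \<open>c\<close> is onto \<open>I\<close>. This yields a unit \<open>e\<close>, excludes zero
  divisors, and reduces every element to an eigenvalue times \<open>e\<close>.\<close>

lemma minimal_ideal_is_line:
  assumes I: "ideal I" and b: "b \<in> I" "br (J b) b \<noteq> 0"
    and minimal: "\<And>K. ideal K \<Longrightarrow> K \<subseteq> I \<Longrightarrow> \<exists>b\<in>K. br (J b) b \<noteq> 0 \<Longrightarrow> K = I"
  obtains e where "e \<in> I" "e \<noteq> 0" "br (J e) e = e" "I = range (\<lambda>t. t *\<^sub>R e)"
proof -
  have sub: "subspace I" and IG: "\<And>x. x \<in> I \<Longrightarrow> x \<in> G"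
    and mem: "\<And>x y. x \<in> I \<Longrightarrow> y \<in> G \<Longrightarrow> br (J y) x \<in> I"
    using I by (auto simp: ideal_def)
  have onto: "br (J c) ` I = I" if c: "c \<in> I" "br (J c) c \<noteq> 0" for c
  proof (rule minimal)
    have "br (J B) (br (J c) x) = br (J c) (br (J B) x)" if "x \<in> I" for B x
      using ad_commute[OF IG[OF that]] by simp
    then show "ideal (br (J c) ` I)"
      using mem IG c unfolding ideal_def
      by (auto intro!: linear_subspace_image linear_br_right sub)
    show "br (J c) ` I \<subseteq> I" using mem IG c by auto
    have "br (J (br (J c) c)) (br (J c) c) \<noteq> 0"
      using square_eq_0_if_fourth_power_eq_0[OF IG] c by blast
    then show "\<exists>b\<in>br (J c) ` I. br (J b) b \<noteq> 0" using c by blast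
  qed
  have "b \<in> br (J b) ` I" using onto[OF b] b by simp
  then obtain e where e: "e \<in> I" "br (J b) e = b" by auto
  \<comment> \<open>Every \<open>x\<close> is a multiple of \<open>b\<close>, and \<open>e\<close>
    fixes \<open>b\<close>; associativity carries this over to \<open>x\<close>.\<close>
  have unit: "br (J e) x = x" if "x \<in> I" for x
  proof -
    have "x \<in> br (J b) ` I" using onto[OF b] that by simp
    then obtain y where y: "y \<in> I" "x = br (J b) y" by auto
    have "br (J e) x = br (J (br (J e) b)) y"
      using y mult_assoc[OF IG[OF b(1)], of e y] by simp
    then show ?thesis using y e mult_commute[of e b] by simp
  qed
  have "e \<noteq> 0" using e b by (auto simp: br_simps J_simps)
  \<comment> \<open>An element of square zero is central, hence annihilated by the unit, which also
    fixes it.\<close>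
  have nz: "br (J c) c \<noteq> 0" if "c \<in> I" "c \<noteq> 0" for c
    using br_eq_0_if_square_eq_0[of c "J e"] unit[of c] that by metis
  have "\<exists>t. x = t *\<^sub>R e" if x: "x \<in> I" for x
  proof -
    have "br (J x) y \<bullet> z = y \<bullet> br (J x) z" if "y \<in> I" "z \<in> I" for y z
      using inner_mult_swap[of x y e z] that x e IG unit by (simp add: inner_commute)
    then obtain t c where c: "c \<in> I" "c \<noteq> 0" "br (J x) c = t *\<^sub>R c"
      using symmetric_operator_eigenvector[OF linear_br_right sub, of "J x"] mem IG x e(1) \<open>e \<noteq> 0\<close>
      by (metis singletonD)
    \<comment> \<open>\<open>M\<close> annihilates the eigenvector \<open>c\<close>, and
      \<open>e\<close> is a multiple of \<open>c\<close>, so \<open>M\<close> annihilates the unit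
      and is zero.\<close>
    define M where "M = x - t *\<^sub>R e"
    have MI: "M \<in> I" using x e sub by (simp add: M_def subspace_diff subspace_scale)
    have Mc: "br (J M) c = 0" using c unit[of c] by (simp add: M_def J_simps br_simps)
    have "e \<in> br (J c) ` I" using onto[OF c(1) nz[OF c(1,2)]] e by simp
    then obtain y where y: "y \<in> I" "e = br (J c) y" by auto
    have "M = br (J M) e" using unit[OF MI] mult_commute[of e M] by simp
    also have "\<dots> = br (J (br (J M) c)) y" using y mult_assoc[OF IG[OF c(1)], of M y] by simp
    also have "\<dots> = 0" by (simp add: Mc J_simps br_simps)
    finally show ?thesis by (auto simp: M_def)
  qed
  then have "I = range (\<lambda>t. t *\<^sub>R e)" using sub e by (auto simp: subspace_scale)
  then show thesis using that e \<open>e \<noteq> 0\<close> unit by blast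
qed

text \<open>Normalized generators of the one-dimensional ideals with non-zero product:
  \<open>X\<close> divided by \<open>l\<close> is an idempotent.\<close>

definition axes :: "'a set" where
  "axes = {X \<in> G. norm X = 1 \<and> (\<exists>l. l \<noteq> 0 \<and> br (J X) X = l *\<^sub>R X)
    \<and> (\<forall>A\<in>G. br (J X) A \<in> range (\<lambda>t. t *\<^sub>R X))}"

text \<open>Otherwise some ideal inside \<open>W\<close> with a non-zero square has least dimension.
  It is the line of an idempotent, and the normalized idempotent is an axis in
  \<open>W\<close>.\<close>

lemma ideal_contains_axis:
  assumes W: "ideal W" and nil: "W \<inter> axes = {}" and A: "A \<in> W"
  shows "br (J A) A = 0"
proof (rule ccontr)
  assume nz: "br (J A) A \<noteq> 0"
  define Q where "Q I \<longleftrightarrow> ideal I \<and> I \<subseteq> W \<and> (\<exists>b\<in>I. br (J b) b \<noteq> 0)" for I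
  have "Q W" using W A nz by (auto simp: Q_def)
  then obtain I where I: "Q I" and min: "\<And>K. Q K \<Longrightarrow> dim I \<le> dim K"
    using ex_has_least_nat[of Q W dim] by blast
  obtain b where b: "b \<in> I" "br (J b) b \<noteq> 0" using I by (auto simp: Q_def)
  have minimal: "K = I" if "ideal K" "K \<subseteq> I" "\<exists>b\<in>K. br (J b) b \<noteq> 0" for K
    using that I min[of K] by (intro subspace_dim_equal) (auto simp: Q_def ideal_def)
  have "ideal I" using I by (simp add: Q_def)
  then obtain e where e: "e \<in> I" "e \<noteq> 0" "br (J e) e = e" "I = range (\<lambda>t. t *\<^sub>R e)"
    by (rule minimal_ideal_is_line[OF _ b minimal])
  define X where "X = (1 / norm e) *\<^sub>R e"
  have XI: "X \<in> I" using e by (auto simp: X_def)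
  have "br (J X) X = (1 / norm e) *\<^sub>R X" using e by (simp add: X_def J_simps br_simps)
  moreover have "br (J X) B \<in> range (\<lambda>t. t *\<^sub>R X)" if "B \<in> G" for B
  proof -
    have "br (J B) X \<in> I" using I XI that by (auto simp: Q_def ideal_def)
    then obtain t where "br (J B) X = t *\<^sub>R e" using e by auto
    then have "br (J X) B = (t * norm e) *\<^sub>R X" using e mult_commute[of X B] by (simp add: X_def)
    then show ?thesis by auto
  qed
  moreover have "X \<in> G" using XI I by (auto simp: Q_def ideal_def)
  ultimately have "X \<in> axes" using e unfolding axes_def
    by (auto simp: X_def intro!: exI[of _ "1 / norm e"])
  then show False using XI I nil by (auto simp: Q_def)
qed

text \<open>\<open>br y\<close> commutes with the multiplication by \<open>X\<close>, whose values
  on \<open>G\<close> lie in the line of \<open>X\<close>; so \<open>l\<close> times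
  \<open>br y X\<close> lies in that line.\<close>

lemma br_axis: "br y X = (br y X \<bullet> X) *\<^sub>R X" if X: "X \<in> axes"
proof -
  obtain l where l: "l \<noteq> 0" "br (J X) X = l *\<^sub>R X" and XG: "X \<in> G" and nX: "norm X = 1"
    and line: "\<And>A. A \<in> G \<Longrightarrow> br (J X) A \<in> range (\<lambda>t. t *\<^sub>R X)"
    using X by (auto simp: axes_def)
  have "l *\<^sub>R br y X = br (J X) (br y X)"
    using ad_commute[OF XG, of y "J X"] l by (simp add: br_simps)
  then obtain t where "l *\<^sub>R br y X = t *\<^sub>R X" using line[OF br_in_G] by auto
  then have "(1/l) *\<^sub>R (l *\<^sub>R br y X) = (t / l) *\<^sub>R X" by (metis scaleR_scaleR times_divide_eq_left mult_1)
  then have "br y X = (t / l) *\<^sub>R X" using l by simp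
  then show ?thesis using nX by (simp add: dot_square_norm)
qed

text \<open>Multiplication by an axis is a multiple of the orthogonal projection onto it. On a
  spanning vector \<open>br (J x) x\<close>, \<open>mult_square\<close> computes the product and
  \<open>inner_square_mult\<close> the inner product with \<open>X\<close>; both give the same sum
  of two squares.\<close>

lemma axis_mult:
  assumes X: "X \<in> axes" and A: "A \<in> G"
  shows "br (J X) A = (br (J X) X \<bullet> X * (X \<bullet> A)) *\<^sub>R X"
proof -
  let ?l = "br (J X) X \<bullet> X" and ?\<mu> = "\<lambda>x. br x X \<bullet> X"
  have XX: "X \<bullet> X = 1" using X by (simp add: axes_def dot_square_norm)
  have lX: "br (J X) X = ?l *\<^sub>R X" by (rule br_axis[OF X])
  define f where "f B = br (J X) B - (?l * (X \<bullet> B)) *\<^sub>R X" for B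
  have "linear f"
    by (auto intro!: linearI simp: f_def br_simps inner_add_right algebra_simps)
  moreover have "f B = 0" if "B \<in> range (\<lambda>x. br (J x) x)" for B
  proof -
    obtain x where B: "B = br (J x) x" using \<open>B \<in> _\<close> by blast
    have "br x X = ?\<mu> x *\<^sub>R X" "br (J x) X = ?\<mu> (J x) *\<^sub>R X" using br_axis[OF X] by blast+
    then have "br x (br x X) = (?\<mu> x * ?\<mu> x) *\<^sub>R X"
        "br (J x) (br (J x) X) = (?\<mu> (J x) * ?\<mu> (J x)) *\<^sub>R X"
      using bilinear_rmul[OF bilinear_br] by (metis scaleR_scaleR)+
    then have "br (J X) B = (?\<mu> x * ?\<mu> x + ?\<mu> (J x) * ?\<mu> (J x)) *\<^sub>R X"
      using mult_square[of X x] by (simp add: B scaleR_add_left)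
    moreover have "?l * (X \<bullet> B) = ?\<mu> x * ?\<mu> x + ?\<mu> (J x) * ?\<mu> (J x)"
    proof -
      have "?l * (X \<bullet> B) = B \<bullet> br (J X) X"
        by (subst (2) lX) (simp add: inner_commute)
      also have "\<dots> = br x X \<bullet> br x X + br (J x) X \<bullet> br (J x) X"
        unfolding B by (rule inner_square_mult)
      also have "br x X \<bullet> br x X = ?\<mu> x * ?\<mu> x"
        by (metis br_axis[OF X] inner_scaleR_right)
      also have "br (J x) X \<bullet> br (J x) X = ?\<mu> (J x) * ?\<mu> (J x)"
        by (metis br_axis[OF X] inner_scaleR_right)
      finally show ?thesis .
    qed
    ultimately show ?thesis by (simp add: f_def)
  qed
  moreover have "A \<in> span (range (\<lambda>x. br (J x) x))"
    using A G_subset_span_squares[OF br_J_J] by blast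
  ultimately have "f A = 0" using linear_eq_0_on_span by blast
  then show ?thesis by (simp add: f_def)
qed

lemma axis_coefficient_neq_0: "X \<in> axes \<Longrightarrow> br (J X) X \<bullet> X \<noteq> 0"
  by (auto simp: axes_def dot_square_norm)

text \<open>The product of \<open>X\<close> and \<open>Y\<close> is a multiple of \<open>X\<close>
  and of \<open>Y\<close>, with coefficients that are non-zero unless
  \<open>X \<bullet> Y = 0\<close>.\<close>

lemma axes_orthogonal:
  assumes "X \<in> axes" "Y \<in> axes" "Y \<notin> range (\<lambda>t. t *\<^sub>R X)"
  shows "X \<bullet> Y = 0"
proof (rule ccontr)
  assume nz: "X \<bullet> Y \<noteq> 0"
  define a where "a = br (J X) X \<bullet> X * (X \<bullet> Y)"
  define b where "b = br (J Y) Y \<bullet> Y * (X \<bullet> Y)"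
  have "b \<noteq> 0" using nz axis_coefficient_neq_0[OF assms(2)] by (simp add: b_def)
  have "X \<in> G" "Y \<in> G" using assms by (auto simp: axes_def)
  then have "a *\<^sub>R X = b *\<^sub>R Y"
    using axis_mult[OF assms(1), of Y] axis_mult[OF assms(2), of X] mult_commute[of X Y]
    by (simp add: a_def b_def inner_commute)
  then have "(1 / b) *\<^sub>R (b *\<^sub>R Y) = (a / b) *\<^sub>R X"
    by (metis scaleR_scaleR times_divide_eq_left mult_1)
  then have "Y = (a / b) *\<^sub>R X" using \<open>b \<noteq> 0\<close> by simp
  then show False using assms(3) by blast
qed

text \<open>By \<open>axis_mult\<close>, orthogonality to an axis means being annihilated by it, so
  the complement \<open>W\<close> of the axes in \<open>G\<close> is an ideal. It contains no axis,
  hence its elements have square zero and are central.\<close>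

lemma br_orthogonal_to_axes:
  assumes A: "A \<in> G" and orth: "\<And>X. X \<in> axes \<Longrightarrow> X \<bullet> A = 0"
  shows "br x A = 0"
proof -
  define W where "W = G \<inter> {A. \<forall>X\<in>axes. X \<bullet> A = 0}"
  have "subspace {A. \<forall>X\<in>axes. X \<bullet> A = 0}"
    by (auto simp: subspace_def inner_simps)
  then have "subspace W" unfolding W_def by (intro subspace_inter subspace_G)
  moreover have "br (J B) C \<in> W" if C: "C \<in> W" and B: "B \<in> G" for B C
  proof -
    have "X \<bullet> br (J B) C = 0" if X: "X \<in> axes" for X
    proof -
      have CG: "C \<in> G" and XC: "X \<bullet> C = 0" using C X by (auto simp: W_def)
      have "br (J X) (br (J B) C) = br (J B) (br (J X) C)" using ad_commute[OF CG] .
      also have "\<dots> = 0" using axis_mult[OF X CG] XC by (simp add: br_simps)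
      finally have "(br (J X) X \<bullet> X * (X \<bullet> br (J B) C)) *\<^sub>R X = 0"
        using axis_mult[OF X br_in_G] by metis
      moreover have "X \<noteq> 0" using X by (auto simp: axes_def)
      ultimately show ?thesis using axis_coefficient_neq_0[OF X] by simp
    qed
    then show ?thesis by (simp add: W_def)
  qed
  ultimately have "ideal W" by (auto simp: ideal_def W_def)
  moreover have "W \<inter> axes = {}"
  proof -
    have "X \<bullet> X \<noteq> 0" if "X \<in> axes" for X using that by (auto simp: axes_def)
    then show ?thesis by (auto simp: W_def)
  qed
  moreover have "A \<in> W" using A orth by (simp add: W_def)
  ultimately have "br (J A) A = 0" by (rule ideal_contains_axis)
  then show ?thesis by (rule br_eq_0_if_square_eq_0)
qed

end

section \<open>Diagonal frames\<close>

lemma orthonormal_expansion: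
  fixes X :: "'i \<Rightarrow> 'a::real_inner"
  assumes "finite I"
    and on: "\<And>i j. i \<in> I \<Longrightarrow> j \<in> I \<Longrightarrow> X i \<bullet> X j = (if i = j then 1 else 0)"
    and A: "A \<in> span (X ` I)"
  shows "A = (\<Sum>i\<in>I. (A \<bullet> X i) *\<^sub>R X i)"
proof -
  define f where "f A = A - (\<Sum>i\<in>I. (A \<bullet> X i) *\<^sub>R X i)" for A
  have "linear f"
    by (auto intro!: linearI simp: f_def inner_add_left scaleR_add_left sum.distrib
        scaleR_diff_right scaleR_sum_right)
  moreover have "f (X k) = 0" if k: "k \<in> I" for k
  proof -
    have "(\<Sum>i\<in>I. (X k \<bullet> X i) *\<^sub>R X i) = (\<Sum>i\<in>I. if k = i then X i else 0)"
      using on[OF k] by (intro sum.cong) auto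
    then show ?thesis using assms(1) k by (simp add: f_def)
  qed
  ultimately have "f A = 0" using A linear_eq_0_on_span[of f "X ` I" A] by blast
  then show ?thesis by (simp add: f_def)
qed

lemma wedge22_self:
  "wedge22 \<nu> \<nu> w x y z = 2 * (\<nu> w x * \<nu> y z - \<nu> w y * \<nu> x z + \<nu> w z * \<nu> x y)"
  by (simp add: wedge22_def)

section \<open>The orthogonal complement of \<open>G\<close> and its image under
  \<open>J\<close>\<close>

context two_step_hermitian
begin

abbreviation U :: "'a set" where "U \<equiv> U_space br J"

lemma mem_U_iff: "u \<in> U \<longleftrightarrow> (\<forall>A\<in>G. A \<bullet> u = 0 \<and> J A \<bullet> u = 0)"
proof
  assume u: "u \<in> U"
  have *: "(A + J B) \<bullet> u = 0" if "A \<in> G" "B \<in> G" for A B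
    using u that by (auto simp: U_space_def orthogonal_comp_def orthogonal_def)
  show "\<forall>A\<in>G. A \<bullet> u = 0 \<and> J A \<bullet> u = 0"
    using *[of _ 0] *[of 0] subspace_0[OF subspace_G] by (simp add: J_simps)
qed (auto simp: U_space_def orthogonal_comp_def orthogonal_def inner_add_left)

lemma J_U: "u \<in> U \<Longrightarrow> J u \<in> U"
  by (simp add: mem_U_iff inner_J inner_J_right)

lemma decomposition_exists:
  obtains A B u where "A \<in> G" "B \<in> G" "u \<in> U" "v = A + J B + u"
proof -
  let ?S = "{x + J y |x y. x \<in> G \<and> y \<in> G}"
  have "?S = {x + y |x y. x \<in> G \<and> y \<in> J ` G}" by blast
  then have "subspace ?S"
    using subspace_sums[OF subspace_G linear_subspace_image[OF linear_J subspace_G]] by simp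
  then have "v \<in> ?S + U"
    using subspace_sum_orthogonal_comp unfolding U_space_def by blast
  then show thesis using that by (auto elim!: set_plus_elim)
qed

lemma mem_span_G_J_U:
  assumes "span S = G"
  shows "v \<in> span (S \<union> J ` S \<union> U)"
proof -
  obtain A B u where v: "A \<in> G" "B \<in> G" "u \<in> U" "v = A + J B + u"
    by (rule decomposition_exists)
  have "J B \<in> span (J ` S)" "A \<in> span S" "u \<in> span U"
    using v assms linear_span_image[OF linear_J, of S] by (auto intro: span_base)
  moreover have "span S \<subseteq> span (S \<union> J ` S \<union> U)" "span (J ` S) \<subseteq> span (S \<union> J ` S \<union> U)"
    "span U \<subseteq> span (S \<union> J ` S \<union> U)"
    by (intro span_mono; blast)+
  ultimately show ?thesis unfolding v(4) by (intro span_add) (rule subsetD; assumption)+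
qed

end

text \<open>The common ground of both directions: the pluriclosed identity is not among the
  assumptions. All \<open>br v\<close> act diagonally on \<open>G\<close>; the first
  \<open>r\<close> basis vectors have non-zero square and the others are central.\<close>

locale diagonal_frame = abelian_complex +
  fixes X :: "nat \<Rightarrow> 'a" and m r :: nat
  assumes orthonormal: "i \<in> {1..m} \<Longrightarrow> j \<in> {1..m} \<Longrightarrow> X i \<bullet> X j = (if i = j then 1 else 0)"
    and span_X: "span (X ` {1..m}) = G"
    and r_le_m: "r \<le> m"
    and br_X: "i \<in> {1..r} \<Longrightarrow> br v (X i) = (br v (X i) \<bullet> X i) *\<^sub>R X i"
    and br_X_0: "i \<in> {r+1..m} \<Longrightarrow> br v (X i) = 0"
    and mult_X: "i \<in> {1..m} \<Longrightarrow> j \<in> {1..m} \<Longrightarrow> i \<noteq> j \<Longrightarrow> br (J (X i)) (X j) = 0"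
    and inner_square_X_neq_0: "i \<in> {1..r} \<Longrightarrow> br (J (X i)) (X i) \<bullet> X i \<noteq> 0"
begin

text \<open>On \<open>U\<close> the functionals \<open>weight i\<close> play the role of the
  \<mu>_i, and \<open>comp_form j\<close> with \<open>j\<close> above \<open>r\<close> that of the
  two-forms; \<open>coeff i\<close> is \<lambda>_i. All are defined on the whole space.\<close>

definition weight :: "nat \<Rightarrow> 'a \<Rightarrow> real" where "weight i v = br v (X i) \<bullet> X i"

definition coeff :: "nat \<Rightarrow> real" where "coeff i = weight i (J (X i))"

definition comp_form :: "nat \<Rightarrow> 'a \<Rightarrow> 'a \<Rightarrow> real" where "comp_form j y z = br y z \<bullet> X j"

lemma index_le: "i \<in> {1..r} \<Longrightarrow> i \<in> {1..m}" "i \<in> {r+1..m} \<Longrightarrow> i \<in> {1..m}"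
  using r_le_m by auto

lemma X_in_G: "i \<in> {1..m} \<Longrightarrow> X i \<in> G"
  using span_base[of "X i" "X ` {1..m}"] span_X by simp

lemma br_eq_weight: "i \<in> {1..r} \<Longrightarrow> br v (X i) = weight i v *\<^sub>R X i"
  using br_X by (simp add: weight_def)

lemma coeff_neq_0: "i \<in> {1..r} \<Longrightarrow> coeff i \<noteq> 0"
  using inner_square_X_neq_0 by (simp add: coeff_def weight_def)

lemma weight_simps: "weight i (v + w) = weight i v + weight i w" "weight i (v - w) = weight i v - weight i w"
  "weight i (- v) = - weight i v" "weight i (c *\<^sub>R v) = c * weight i v" "weight i 0 = 0"
  by (simp_all add: weight_def br_simps inner_add_left inner_diff_left)

lemma linear_weight: "linear (weight i)"
  by (auto intro!: linearI simp: weight_simps)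

lemma weight_G: "i \<in> {1..m} \<Longrightarrow> A \<in> G \<Longrightarrow> weight i A = 0"
  by (simp add: weight_def br_G_G X_in_G)

lemma mult_X_left: "br (J (X i)) A = (coeff i * (A \<bullet> X i)) *\<^sub>R X i" if i: "i \<in> {1..r}" and A: "A \<in> G"
proof -
  define f where "f B = br (J (X i)) B - (coeff i * (B \<bullet> X i)) *\<^sub>R X i" for B
  have "linear f"
    by (auto intro!: linearI simp: f_def br_simps inner_add_left algebra_simps)
  moreover have "f B = 0" if B: "B \<in> X ` {1..m}" for B
  proof -
    obtain j where j: "j \<in> {1..m}" "B = X j" using B by (elim imageE)
    show ?thesis
    proof (cases "j = i")
      case True
      then show ?thesis using j i orthonormal[of i i] br_eq_weight[OF i, of "J (X i)"]
        by (simp add: f_def coeff_def)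
    next
      case False
      then show ?thesis using j index_le(1)[OF i] orthonormal[of j i] mult_X[of i j] by (simp add: f_def)
    qed
  qed
  ultimately have "f A = 0" using A span_X linear_eq_0_on_span by blast
  then show ?thesis by (simp add: f_def)
qed

lemma weight_J_G: "weight i (J A) = coeff i * (A \<bullet> X i)" if i: "i \<in> {1..r}" and A: "A \<in> G"
proof -
  have "br (J A) (X i) = (coeff i * (A \<bullet> X i)) *\<^sub>R X i"
    using mult_commute[of A "X i"] mult_X_left[OF that] by simp
  then show ?thesis using orthonormal[of i i] index_le(1)[OF i] by (simp add: weight_def)
qed

text \<open>The product of \<open>X i\<close> with \<open>br y z\<close> is computed twice: as a
  multiple of the \<open>X i\<close>-component, and through \<open>mult_br\<close> from the action
  on the line of \<open>X i\<close>. This forces the first \<open>r\<close> components of the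
  bracket.\<close>

lemma coeff_comp_form:
  assumes i: "i \<in> {1..r}"
  shows "coeff i * comp_form i y z = wedge11 (weight i) (weight i \<circ> J) y z"
proof -
  have "br y (br (J z) (X i)) = (weight i (J z) * weight i y) *\<^sub>R X i"
    "br z (br (J y) (X i)) = (weight i (J y) * weight i z) *\<^sub>R X i"
    using br_eq_weight[OF i] by (simp_all add: br_simps)
  then have "br (J (X i)) (br y z) = (weight i y * weight i (J z) - weight i z * weight i (J y)) *\<^sub>R X i"
    by (simp add: mult_br scaleR_diff_left mult.commute)
  then have "(coeff i * (br y z \<bullet> X i)) *\<^sub>R X i =
      (weight i y * weight i (J z) - weight i z * weight i (J y)) *\<^sub>R X i"
    by (simp add: mult_X_left[OF i])
  moreover have "X i \<noteq> 0" using orthonormal[of i i] index_le(1)[OF i] by auto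
  ultimately show ?thesis by (simp add: comp_form_def wedge11_def)
qed

lemma comp_form_eq: "i \<in> {1..r} \<Longrightarrow> comp_form i y z = 1 / coeff i * wedge11 (weight i) (weight i \<circ> J) y z"
  using coeff_comp_form[of i y z, symmetric] coeff_neq_0[of i] by simp

lemma br_expansion: "br y z = (\<Sum>i=1..m. comp_form i y z *\<^sub>R X i)"
  unfolding comp_form_def
  by (rule orthonormal_expansion) (simp_all only: orthonormal span_X br_in_G finite_atLeastAtMost)

lemma comp_form_G: "comp_form j v A = 0" if j: "j \<in> {r+1..m}" and A: "A \<in> G"
proof -
  have "linear (comp_form j v)"
    by (auto intro!: linearI simp: comp_form_def br_simps inner_add_left)
  moreover have "comp_form j v B = 0" if B: "B \<in> X ` {1..m}" for B
  proof -
    obtain i where i: "i \<in> {1..m}" "B = X i" using B by (elim imageE)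
    show ?thesis
    proof (cases "i \<le> r")
      case True
      then have "i \<in> {1..r}" "i \<noteq> j" using i j by auto
      then show ?thesis
        using i j br_eq_weight[of i v] orthonormal[of i j] by (simp add: comp_form_def)
    next
      case False
      then show ?thesis using i br_X_0[of i] by (simp add: comp_form_def)
    qed
  qed
  ultimately show ?thesis using A span_X linear_eq_0_on_span by blast
qed

lemma comp_form_skew: "comp_form j v w = - comp_form j w v"
  using br_skew[of v w] by (simp add: comp_form_def)

lemma comp_form_J: "comp_form j (J v) (J w) = comp_form j v w"
  by (simp add: comp_form_def br_J_J)

lemma comp_form_J_right: "comp_form j v (J w) = - comp_form j (J v) w"
  by (simp add: comp_form_def br_J_left)

lemma comp_form_add: "comp_form j (v + v') w = comp_form j v w + comp_form j v' w"
  "comp_form j v (w + w') = comp_form j v w + comp_form j v w'"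
  by (simp_all add: comp_form_def br_simps inner_add_left)

text \<open>For \<open>j\<close> above \<open>r\<close>, no bracket with an element of
  \<open>G\<close> has an \<open>X j\<close>-component. By invariance under \<open>J\<close>, both
  \<open>G\<close> and its image under \<open>J\<close> lie in the radical of the form.\<close>

lemma comp_form_U_part:
  assumes j: "j \<in> {r+1..m}" and G: "A \<in> G" "B \<in> G" "A' \<in> G" "B' \<in> G"
  shows "comp_form j (A + J B + u) (A' + J B' + u') = comp_form j u u'"
proof -
  have 0: "comp_form j v C = 0" "comp_form j v (J C) = 0" "comp_form j C v = 0" "comp_form j (J C) v = 0"
    if "C \<in> G" for v C
    using comp_form_G[OF j that] comp_form_J_right[of j v C]
      comp_form_skew[of j v C] comp_form_skew[of j v "J C"] by simp_all
  show ?thesis by (simp add: comp_form_add 0 G)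
qed

text \<open>For \<open>i\<close> up to \<open>r\<close> the form is a multiple of a wedge of two
  one-forms, so its wedge square vanishes. The factor 1/2 undoes the doubling in
  \<open>wedge22_self\<close>.\<close>

lemma pluriclosed_sum:
  "br w x \<bullet> br y z - br w y \<bullet> br x z + br w z \<bullet> br x y =
   1/2 * (\<Sum>j=r+1..m. wedge22 (comp_form j) (comp_form j) w x y z)"
proof -
  have ip: "br a b \<bullet> br c d = (\<Sum>i=1..m. comp_form i a b * comp_form i c d)" for a b c d
  proof -
    have "br a b \<bullet> br c d = br a b \<bullet> (\<Sum>i=1..m. comp_form i c d *\<^sub>R X i)"
      using br_expansion[of c d] by simp
    then show ?thesis by (simp add: inner_sum_right comp_form_def mult.commute)
  qed
  have "wedge22 (comp_form i) (comp_form i) w x y z = 0" if "i \<in> {1..r}" for i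
  proof -
    define c where "c = 1 / coeff i"
    show ?thesis
      unfolding wedge22_self comp_form_eq[OF that] c_def[symmetric] wedge11_def o_apply
      by (simp add: algebra_simps)
  qed
  then have "(\<Sum>i=1..r. wedge22 (comp_form i) (comp_form i) w x y z) = 0" by simp
  moreover have "{1..m} = {1..r} \<union> {r+1..m}" "{1..r} \<inter> {r+1..m} = {}" using r_le_m by auto
  ultimately have "(\<Sum>j=r+1..m. wedge22 (comp_form j) (comp_form j) w x y z) =
      (\<Sum>i=1..m. wedge22 (comp_form i) (comp_form i) w x y z)"
    by (simp add: sum.union_disjoint)
  then show ?thesis
    by (simp add: ip wedge22_self sum.distrib sum_subtractf sum_distrib_left[symmetric])
qed

lemma pluriclosed_iff_U:
  "(\<forall>w x y z. br w x \<bullet> br y z - br w y \<bullet> br x z + br w z \<bullet> br x y = 0) \<longleftrightarrow>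
   (\<forall>w\<in>U. \<forall>x\<in>U. \<forall>y\<in>U. \<forall>z\<in>U. (\<Sum>j=r+1..m. wedge22 (comp_form j) (comp_form j) w x y z) = 0)"
proof
  assume R: "\<forall>w\<in>U. \<forall>x\<in>U. \<forall>y\<in>U. \<forall>z\<in>U.
    (\<Sum>j=r+1..m. wedge22 (comp_form j) (comp_form j) w x y z) = 0"
  show "\<forall>w x y z. br w x \<bullet> br y z - br w y \<bullet> br x z + br w z \<bullet> br x y = 0"
  proof (intro allI)
    fix w x y z
    have ex: "\<exists>A B u. A \<in> G \<and> B \<in> G \<and> u \<in> U \<and> v = A + J B + u" for v
      by (metis decomposition_exists)
    obtain A1 B1 u1 where 1: "A1 \<in> G" "B1 \<in> G" "u1 \<in> U" "w = A1 + J B1 + u1" using ex[of w] by auto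
    obtain A2 B2 u2 where 2: "A2 \<in> G" "B2 \<in> G" "u2 \<in> U" "x = A2 + J B2 + u2" using ex[of x] by auto
    obtain A3 B3 u3 where 3: "A3 \<in> G" "B3 \<in> G" "u3 \<in> U" "y = A3 + J B3 + u3" using ex[of y] by auto
    obtain A4 B4 u4 where 4: "A4 \<in> G" "B4 \<in> G" "u4 \<in> U" "z = A4 + J B4 + u4" using ex[of z] by auto
    have "wedge22 (comp_form j) (comp_form j) w x y z = wedge22 (comp_form j) (comp_form j) u1 u2 u3 u4"
      if "j \<in> {r+1..m}" for j
      unfolding wedge22_def 1(4) 2(4) 3(4) 4(4)
      by (simp only: comp_form_U_part[OF that] 1(1,2) 2(1,2) 3(1,2) 4(1,2))
    then have "(\<Sum>j=r+1..m. wedge22 (comp_form j) (comp_form j) w x y z) =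
        (\<Sum>j=r+1..m. wedge22 (comp_form j) (comp_form j) u1 u2 u3 u4)"
      by (rule sum.cong[OF refl])
    also have "\<dots> = 0" using R 1(3) 2(3) 3(3) 4(3) by blast
    finally have "(\<Sum>j=r+1..m. wedge22 (comp_form j) (comp_form j) w x y z) = 0" .
    then show "br w x \<bullet> br y z - br w y \<bullet> br x z + br w z \<bullet> br x y = 0"
      by (simp only: pluriclosed_sum mult_zero_right)
  qed
qed (simp add: pluriclosed_sum)

text \<open>The orthogonal projection \<pi> onto the last basis vectors maps a bracket to a value
  that only depends on the \<open>U\<close>-parts of its arguments. Brackets span \<open>G\<close>,
  and \<pi> fixes each \<open>X k\<close> with \<open>k\<close> above \<open>r\<close>.\<close>

lemma Lambda2_image_eq:
  "Lambda2_image U (\<lambda>y z. \<Sum>j=r+1..m. comp_form j y z *\<^sub>R X j) = span (X ` {r+1..m})"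
    (is "?L = ?R")
proof
  have "(\<Sum>j=r+1..m. comp_form j y z *\<^sub>R X j) \<in> ?R" for y z
    by (intro span_sum span_scale span_base imageI)
  then show "?L \<subseteq> ?R" unfolding Lambda2_image_def
    by (intro span_minimal subspace_span) auto
  define \<pi> where "\<pi> A = (\<Sum>j=r+1..m. (A \<bullet> X j) *\<^sub>R X j)" for A
  have lin: "linear \<pi>"
    by (auto intro!: linearI simp: \<pi>_def inner_add_left scaleR_add_left sum.distrib scaleR_sum_right)
  have \<pi>_br: "\<pi> (br v w) = (\<Sum>j=r+1..m. comp_form j v w *\<^sub>R X j)" for v w
    by (simp add: \<pi>_def comp_form_def)
  have "\<pi> (br v w) \<in> ?L" for v w
  proof -
    obtain A B u where v: "A \<in> G" "B \<in> G" "u \<in> U" "v = A + J B + u" by (rule decomposition_exists)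
    obtain A' B' u' where w: "A' \<in> G" "B' \<in> G" "u' \<in> U" "w = A' + J B' + u'"
      by (rule decomposition_exists)
    have "\<pi> (br v w) = (\<Sum>j=r+1..m. comp_form j u u' *\<^sub>R X j)"
      unfolding \<pi>_br v(4) w(4)
      by (rule sum.cong) (simp_all add: comp_form_U_part v(1,2) w(1,2))
    then show ?thesis unfolding Lambda2_image_def using v w by (auto intro!: span_base)
  qed
  then have "\<pi> ` {br x y |x y. x \<in> UNIV \<and> y \<in> UNIV} \<subseteq> ?L" by auto
  then have \<pi>_G: "\<pi> ` G \<subseteq> ?L"
    unfolding commutator_def linear_span_image[OF lin, symmetric]
    by (intro span_minimal) (auto simp: Lambda2_image_def)
  have "X k \<in> ?L" if k: "k \<in> {r+1..m}" for k
  proof -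
    have "\<pi> (X k) = (\<Sum>j=r+1..m. (if k = j then X j else 0))"
      unfolding \<pi>_def using k by (intro sum.cong) (auto simp: orthonormal)
    then have "\<pi> (X k) = X k" using k by simp
    moreover have "\<pi> (X k) \<in> ?L" using \<pi>_G X_in_G[OF index_le(2)[OF k]] by (rule subsetD[OF _ imageI])
    ultimately show ?thesis by simp
  qed
  then have "X ` {r+1..m} \<subseteq> ?L" by (rule image_subsetI)
  then show "?R \<subseteq> ?L"
    by (rule span_minimal) (simp add: Lambda2_image_def)
qed

end

section \<open>Splitting off the affine factors\<close>

context diagonal_frame
begin

text \<open>The projection onto the span of the \<open>X i\<close> and \<open>J (X i)\<close> with
  \<open>i\<close> up to \<open>r\<close>, along \<open>kernel\<close>. The coefficients are those
  for which \<open>v\<close> and its image agree under each \<open>weight i\<close> and its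
  composition with \<open>J\<close>.\<close>

definition affine_part :: "'a \<Rightarrow> 'a" where
  "affine_part v =
    (\<Sum>i=1..r. (weight i v / coeff i) *\<^sub>R J (X i) + (weight i (J v) / coeff i) *\<^sub>R X i)"

definition kernel :: "'a set" where
  "kernel = {v. \<forall>i\<in>{1..r}. weight i v = 0 \<and> weight i (J v) = 0}"

lemma linear_affine_part: "linear affine_part"
  by (auto intro!: linearI simp: affine_part_def J_simps weight_simps add_divide_distrib
      scaleR_add_left sum.distrib scaleR_sum_right scaleR_add_right)

lemma subspace_kernel: "subspace kernel"
  by (auto simp: subspace_def kernel_def J_simps weight_simps)

lemma weight_X: "i \<in> {1..r} \<Longrightarrow> k \<in> {1..r} \<Longrightarrow> weight i (X k) = 0"
  by (rule weight_G[OF index_le(1) X_in_G[OF index_le(1)]])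

lemma weight_J_X: "i \<in> {1..r} \<Longrightarrow> k \<in> {1..r} \<Longrightarrow> weight i (J (X k)) = (if i = k then coeff i else 0)"
  using weight_J_G[OF _ X_in_G[OF index_le(1)], of i k] orthonormal[OF index_le(1) index_le(1), of k i] by auto

text \<open>Up to the factors \<open>coeff k\<close>, the functionals \<open>weight i\<close> and
  their compositions with \<open>J\<close> are dual to the vectors \<open>J (X k)\<close> and
  \<open>X k\<close>.\<close>

lemma weight_combination:
  assumes i: "i \<in> {1..r}"
  shows "weight i (\<Sum>k=1..r. (a k / coeff k) *\<^sub>R J (X k) + (b k / coeff k) *\<^sub>R X k) = a i"
    and "weight i (J (\<Sum>k=1..r. (a k / coeff k) *\<^sub>R J (X k) + (b k / coeff k) *\<^sub>R X k)) = b i"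
proof -
  have *: "(\<Sum>k=1..r. c k / coeff k * weight i (J (X k))) = c i" for c :: "nat \<Rightarrow> real"
  proof -
    have "(\<Sum>k=1..r. c k / coeff k * weight i (J (X k))) = (\<Sum>k=1..r. if i = k then c k else 0)"
      using i coeff_neq_0 by (intro sum.cong) (auto simp: weight_J_X)
    then show ?thesis using i by simp
  qed
  have X0: "(\<Sum>k=1..r. c k * weight i (X k)) = 0" for c :: "nat \<Rightarrow> real"
    using i by (intro sum.neutral) (simp add: weight_X)
  show "weight i (\<Sum>k=1..r. (a k / coeff k) *\<^sub>R J (X k) + (b k / coeff k) *\<^sub>R X k) = a i"
    using *[of a] X0[of "\<lambda>k. b k / coeff k"]
    by (simp add: linear_sum[OF linear_weight] weight_simps sum.distrib)
  show "weight i (J (\<Sum>k=1..r. (a k / coeff k) *\<^sub>R J (X k) + (b k / coeff k) *\<^sub>R X k)) = b i"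
    using *[of b] X0[of "\<lambda>k. a k / coeff k"]
    by (simp add: linear_sum[OF linear_weight] linear_sum[OF linear_J] J_simps weight_simps
        sum.distrib sum_negf)
qed

lemma weight_affine_part:
  assumes "i \<in> {1..r}"
  shows "weight i (affine_part v) = weight i v" "weight i (J (affine_part v)) = weight i (J v)"
  unfolding affine_part_def by (rule weight_combination[OF assms])+

lemma affine_part_kernel: "v \<in> kernel \<Longrightarrow> affine_part v = 0"
  by (simp add: affine_part_def kernel_def)

lemma kernel_part: "v - affine_part v \<in> kernel"
  by (simp add: kernel_def J_simps weight_simps weight_affine_part)

lemma affine_part_X: "k \<in> {1..r} \<Longrightarrow> affine_part (X k) = X k"
proof -
  assume k: "k \<in> {1..r}"
  have "affine_part (X k) = (\<Sum>i=1..r. if i = k then X i else 0)"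
    unfolding affine_part_def using k coeff_neq_0
    by (intro sum.cong) (auto simp: weight_X weight_J_X)
  then show ?thesis using k by simp
qed

lemma br_kernel_affine_part: "br v (affine_part w) = 0" if "v \<in> kernel"
proof -
  have "br v (X i) = 0" "br v (J (X i)) = 0" if i: "i \<in> {1..r}" for i
    using \<open>v \<in> kernel\<close> i br_eq_weight[OF i] br_J_left[of v "X i"] by (simp_all add: kernel_def)
  then show ?thesis
    by (simp add: affine_part_def linear_sum[OF linear_br_right] br_simps)
qed

text \<open>The range of \<open>affine_part\<close> is an ideal: \<open>br v\<close> maps both
  \<open>X i\<close> and \<open>J (X i)\<close> into the line of \<open>X i\<close>, which
  \<open>affine_part\<close> fixes.\<close>

lemma affine_part_br_affine_part: "affine_part (br v (affine_part w)) = br v (affine_part w)"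
proof -
  have 1: "br v (X i) \<in> span {X i}" "br v (J (X i)) \<in> span {X i}" if i: "i \<in> {1..r}" for i
  proof -
    have "br v (J (X i)) = - br (J v) (X i)" using br_J_left[of v "X i"] by simp
    then show "br v (X i) \<in> span {X i}" "br v (J (X i)) \<in> span {X i}"
      using br_eq_weight[OF i] by (simp_all add: span_neg span_scale span_base)
  qed
  have 2: "span {X i} \<subseteq> {v. affine_part v = v}" if "i \<in> {1..r}" for i
    using that affine_part_X
    by (intro span_minimal)
      (auto simp: subspace_def linear_0[OF linear_affine_part] linear_add[OF linear_affine_part]
        linear_scale[OF linear_affine_part])
  have 3: "affine_part (br v (X i)) = br v (X i)" "affine_part (br v (J (X i))) = br v (J (X i))"
    if "i \<in> {1..r}" for i
    using 1[OF that] 2[OF that] by auto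
  have "br v (affine_part w) =
      (\<Sum>i=1..r. (weight i w / coeff i) *\<^sub>R br v (J (X i)) + (weight i (J w) / coeff i) *\<^sub>R br v (X i))"
    by (simp add: affine_part_def linear_sum[OF linear_br_right] br_simps)
  moreover from this have "affine_part (br v (affine_part w)) =
      (\<Sum>i=1..r. (weight i w / coeff i) *\<^sub>R affine_part (br v (J (X i)))
        + (weight i (J w) / coeff i) *\<^sub>R affine_part (br v (X i)))"
    by (simp add: linear_sum[OF linear_affine_part] linear_add[OF linear_affine_part]
        linear_scale[OF linear_affine_part])
  moreover have "\<dots> =
      (\<Sum>i=1..r. (weight i w / coeff i) *\<^sub>R br v (J (X i)) + (weight i (J w) / coeff i) *\<^sub>R br v (X i))"
    by (rule sum.cong[OF refl]) (simp only: 3)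
  ultimately show ?thesis by simp
qed

text \<open>In the coordinates \<open>(weight i v, weight i (J v))\<close> the bracket is
  \<open>aff_bracket\<close>.\<close>

lemma weight_br:
  assumes "i \<in> {1..r}"
  shows "weight i (br v w) = 0"
    "weight i (J (br v w)) = weight i v * weight i (J w) - weight i (J v) * weight i w"
proof -
  show "weight i (br v w) = 0" by (rule weight_G[OF index_le(1)[OF assms] br_in_G])
  have "weight i (J (br v w)) = coeff i * comp_form i v w"
    by (simp add: weight_J_G[OF assms] comp_form_def)
  then show "weight i (J (br v w)) = weight i v * weight i (J w) - weight i (J v) * weight i w"
    by (simp add: coeff_comp_form[OF assms] wedge11_def mult.commute)
qed

lemma br_in_kernel: "v \<in> kernel \<Longrightarrow> br v w \<in> kernel"
  by (simp add: kernel_def weight_br)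

text \<open>The kernel and the range of \<open>affine_part\<close> are ideals that commute with each
  other, so the projection onto the kernel is a homomorphism.\<close>

lemma kernel_part_br:
  "br v w - affine_part (br v w) = br (v - affine_part v) (w - affine_part w)"
proof -
  define k l a b where kl: "k = v - affine_part v" "l = w - affine_part w"
    and ab: "a = affine_part v" "b = affine_part w"
  have kK: "k \<in> kernel" "l \<in> kernel" by (simp_all add: kl kernel_part)
  have "br k b = 0" "br a l = 0"
    using br_kernel_affine_part kK br_skew[of a l] by (simp_all add: ab)
  moreover have "v = k + a" "w = l + b" by (simp_all add: kl ab)
  ultimately have sum: "br v w = br k l + br a b" by (simp add: br_simps)
  have "affine_part (br a b) = br a b" unfolding ab by (rule affine_part_br_affine_part)
  moreover have "affine_part (br k l) = 0" using br_in_kernel kK by (simp add: affine_part_kernel)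
  ultimately have "br v w - affine_part (br v w) = br k l"
    unfolding sum by (simp add: linear_add[OF linear_affine_part])
  then show ?thesis by (simp add: kl)
qed

text \<open>For \<open>A\<close> in \<open>G\<close>, \<open>weight i (J A)\<close> is
  \<open>coeff i\<close> times the \<open>X i\<close>-component, so \<open>A\<close> has only
  central components left. Hence the lower central series of \<open>kernel\<close> ends after two
  steps.\<close>

lemma br_kernel_nilpotent: "br v A = 0" if "A \<in> kernel" "A \<in> G"
proof -
  have 0: "(A \<bullet> X i) *\<^sub>R br v (X i) = 0" if i: "i \<in> {1..m}" for i
  proof (cases "i \<le> r")
    case True
    then have "i \<in> {1..r}" using i by simp
    then show ?thesis
      using weight_J_G[of i A] coeff_neq_0[of i] \<open>A \<in> kernel\<close> \<open>A \<in> G\<close> by (simp add: kernel_def)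
  next
    case False
    then show ?thesis using i br_X_0[of i] by simp
  qed
  have "A = (\<Sum>i=1..m. (A \<bullet> X i) *\<^sub>R X i)"
    by (rule orthonormal_expansion) (simp_all only: orthonormal span_X that finite_atLeastAtMost)
  then have "br v A = (\<Sum>i=1..m. (A \<bullet> X i) *\<^sub>R br v (X i))"
    by (metis (no_types, lifting) linear_sum[OF linear_br_right] br_simps(8) sum.cong)
  also have "\<dots> = 0" by (rule sum.neutral[OF ballI]) (rule 0)
  finally show ?thesis .
qed

lemma nilpotent_kernel: "nilpotent_lie kernel br"
proof -
  have "{br x y |x y. x \<in> kernel \<and> y \<in> kernel} \<subseteq> kernel \<inter> G" using br_in_kernel by auto
  then have 1: "lower_central kernel br 1 \<subseteq> kernel \<inter> G"
    by (simp add: span_minimal subspace_kernel subspace_G subspace_inter)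
  have "{br x y |x y. x \<in> kernel \<and> y \<in> lower_central kernel br 1} \<subseteq> {0}"
    using 1 br_kernel_nilpotent by blast
  then have "span {br x y |x y. x \<in> kernel \<and> y \<in> lower_central kernel br 1} \<subseteq> {0}"
    by (rule span_minimal) (rule subspace_single_0)
  then have "lower_central kernel br (Suc 1) = {0}"
    using span_0 unfolding lower_central.simps by blast
  then show ?thesis unfolding nilpotent_lie_def by blast
qed

lemma lie_algebra_kernel: "lie_algebra kernel br"
  unfolding lie_algebra_def bilinear_on_def linear_on_def
  using subspace_kernel br_in_kernel jacobi by (auto simp: br_simps)

text \<open>The range of \<open>affine_part\<close> lies in \<open>S\<close>, the sum of
  \<open>E\<close> and its image under \<open>J\<close>. It has dimension \<open>2 * r\<close>
  because \<open>G\<close> is totally real, and the weights show that it meets \<open>kernel\<close>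
  trivially.\<close>

lemma dim_kernel:
  assumes "G \<inter> J ` G = {0}"
  shows "dim kernel + 2 * r = DIM('a)"
proof -
  define E where "E = span (X ` {1..r})"
  have EG: "E \<subseteq> G" unfolding E_def using X_in_G index_le(1) by (intro span_minimal subspace_G) auto
  have E: "subspace E" "subspace (J ` E)"
    by (simp_all add: E_def linear_subspace_image[OF linear_J])
  have injJ: "inj J" by (metis J_J injI minus_equation_iff)
  have injX: "inj_on X {1..r}"
  proof (rule inj_onI)
    fix i j assume ij: "i \<in> {1..r}" "j \<in> {1..r}" "X i = X j"
    then show "i = j"
      using orthonormal[OF index_le(1) index_le(1), of i j] orthonormal[OF index_le(1) index_le(1), of i i]
      by (simp split: if_splits)
  qed
  have "independent (X ` {1..r})"
  proof (rule pairwise_orthogonal_independent)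
    show "pairwise orthogonal (X ` {1..r})"
      using orthonormal[OF index_le(1) index_le(1)] by (auto simp: pairwise_def orthogonal_def)
    have "X i \<noteq> 0" if "i \<in> {1..r}" for i
      using orthonormal[OF index_le(1) index_le(1), of i i] that by auto
    then show "0 \<notin> X ` {1..r}" by auto
  qed
  then have dimE: "dim E = r"
    using injX by (simp add: E_def dim_eq_card_independent card_image)
  have dimJE: "dim (J ` E) = r"
    using dim_image_eq[OF linear_J, of E] injJ dimE inj_on_subset by blast
  define S where "S = {x + y |x y. x \<in> E \<and> y \<in> J ` E}"
  have S: "subspace S" unfolding S_def by (rule subspace_sums[OF E])
  have "E \<inter> J ` E = {0}" using EG assms subspace_0[OF E(1)] subspace_0[OF E(2)] by blast
  then have dimS: "dim S = 2 * r"
    using dim_sums_Int[OF E] dimE dimJE by (simp add: S_def)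
  have "affine_part v \<in> S" for v
  proof -
    have "X i \<in> E" if "i \<in> {1..r}" for i using that by (simp add: E_def span_base)
    then have "X i \<in> S" "J (X i) \<in> S" if "i \<in> {1..r}" for i
      using that subspace_0[OF E(1)] subspace_0[OF E(2)] unfolding S_def by force+
    then show ?thesis unfolding affine_part_def
      by (intro subspace_sum[OF S]) (simp add: subspace_add subspace_scale S)
  qed
  then have "v \<in> {x + y |x y. x \<in> kernel \<and> y \<in> S}" for v
    using kernel_part[of v]
    by (intro CollectI exI[of _ "v - affine_part v"] exI[of _ "affine_part v"] conjI) simp_all
  then have UN: "{x + y |x y. x \<in> kernel \<and> y \<in> S} = UNIV" by blast
  have "kernel \<inter> S \<subseteq> {0}"
  proof
    fix v assume v: "v \<in> kernel \<inter> S"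
    then obtain A B where AB: "A \<in> E" "B \<in> E" "v = A + J B" by (auto simp: S_def)
    have "A \<bullet> X i = 0 \<and> B \<bullet> X i = 0" if i: "i \<in> {1..r}" for i
    proof -
      have G: "A \<in> G" "B \<in> G" using AB EG by auto
      have "weight i v = coeff i * (B \<bullet> X i)" "weight i (J v) = coeff i * (A \<bullet> X i)"
        using weight_J_G[OF i] weight_G[OF index_le(1)[OF i]] G by (simp_all add: AB J_simps weight_simps)
      then show ?thesis using v i coeff_neq_0 by (simp add: kernel_def)
    qed
    moreover have "C = 0" if "C \<in> E" and C: "\<And>i. i \<in> {1..r} \<Longrightarrow> C \<bullet> X i = 0" for C
    proof -
      have "orthogonal C C"
        using that(1) unfolding E_def
        by (rule orthogonal_to_span) (auto simp only: C orthogonal_def)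
      then show ?thesis by (simp add: orthogonal_self)
    qed
    ultimately have "A = 0" "B = 0" using AB(1,2) by blast+
    then show "v \<in> {0}" using AB(3) by (simp add: J_simps)
  qed
  then have "kernel \<inter> S = {0}"
    using subspace_0[OF subspace_kernel] subspace_0[OF S] by blast
  then show ?thesis
    using dim_sums_Int[OF subspace_kernel S] dimS unfolding UN by simp
qed

lemma lie_isomorphic_affine_sum:
  "lie_isomorphic UNIV br (copies_carrier r UNIV \<times> kernel) (sum_bracket (copies_bracket aff_bracket) br)"
proof -
  \<comment> \<open>Copies are indexed from 0 and frame vectors from 1, hence \<open>Suc k\<close>
    here and \<open>i - 1\<close> in the inverse \<open>g\<close>.\<close>
  define F where "F v = (\<lambda>k. if k < r then (weight (Suc k) v, weight (Suc k) (J v)) else 0)" for v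
  define f where "f v = (F v, v - affine_part v)" for v
  define g where "g q = snd q + (\<Sum>i=1..r. (fst (fst q (i - 1)) / coeff i) *\<^sub>R J (X i)
      + (snd (fst q (i - 1)) / coeff i) *\<^sub>R X i)" for q :: "(nat \<Rightarrow> real \<times> real) \<times> 'a"
  have wg: "weight i (g q) = fst (fst q (i - 1))" "weight i (J (g q)) = snd (fst q (i - 1))"
    if q: "q \<in> copies_carrier r UNIV \<times> kernel" and i: "i \<in> {1..r}" for q i
    using weight_combination[OF i] q i
    by (auto simp: g_def weight_simps J_simps linear_add[OF linear_J] kernel_def)
  have gf: "g (f v) = v" for v
  proof -
    have "(\<Sum>i=1..r. (fst (F v (i - 1)) / coeff i) *\<^sub>R J (X i) + (snd (F v (i - 1)) / coeff i) *\<^sub>R X i)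
        = affine_part v"
      unfolding affine_part_def by (rule sum.cong) (auto simp: F_def)
    then show ?thesis by (simp add: g_def f_def)
  qed
  have fg: "f (g q) = q" if q: "q \<in> copies_carrier r UNIV \<times> kernel" for q
  proof -
    have "F (g q) = fst q"
    proof
      fix k show "F (g q) k = fst q k"
        using wg[OF q, of "Suc k"] q by (auto simp: F_def copies_carrier_def)
    qed
    moreover have "affine_part (g q) = g q - snd q"
    proof -
      have "affine_part (g q) = (\<Sum>i=1..r. (fst (fst q (i - 1)) / coeff i) *\<^sub>R J (X i)
          + (snd (fst q (i - 1)) / coeff i) *\<^sub>R X i)"
        unfolding affine_part_def by (rule sum.cong[OF refl]) (simp only: wg[OF q])
      then show ?thesis by (simp add: g_def)
    qed
    ultimately show ?thesis by (simp add: f_def prod_eq_iff)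
  qed
  have "linear_on UNIV f"
    by (auto simp: linear_on_def f_def F_def fun_eq_iff scaleR_fun_def J_simps weight_simps
        linear_add[OF linear_affine_part] linear_scale[OF linear_affine_part] algebra_simps)
  moreover have "bij_betw f UNIV (copies_carrier r UNIV \<times> kernel)"
    by (rule bij_betw_byWitness[where f' = g])
      (auto simp: gf fg, auto simp: f_def F_def copies_carrier_def kernel_part)
  moreover have "f (br v w) = sum_bracket (copies_bracket aff_bracket) br (f v) (f w)" for v w
    by (auto simp: f_def F_def sum_bracket_def copies_bracket_def aff_bracket_def fun_eq_iff
        kernel_part_br weight_br zero_prod_def)
  ultimately show ?thesis unfolding lie_isomorphic_def by blast
qed

end

section \<open>Correspondence between SKT structures and diagonal frames\<close>

context diagonal_frame
begin

lemma SKT_data_if_pluriclosed: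
  assumes "\<forall>w x y z. br w x \<bullet> br y z - br w y \<bullet> br x z + br w z \<bullet> br x y = 0"
  shows "SKT_data br J m X r coeff weight comp_form"
proof -
  have br_JX: "br y (J (X i)) = - br (J y) (X i)" for y i
    using br_J_left[of y "X i"] by simp
  have br_UU: "br y z = (\<Sum>i=1..r. (1 / coeff i * wedge11 (weight i) (weight i \<circ> J) y z) *\<^sub>R X i)
      + (\<Sum>j=r+1..m. comp_form j y z *\<^sub>R X j)" for y z
  proof -
    have "{1..m} = {1..r} \<union> {r+1..m}" "{1..r} \<inter> {r+1..m} = {}" using r_le_m by auto
    then have "br y z = (\<Sum>i=1..r. comp_form i y z *\<^sub>R X i) + (\<Sum>j=r+1..m. comp_form j y z *\<^sub>R X j)"
      using br_expansion[of y z] by (simp add: sum.union_disjoint)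
    also have "(\<Sum>i=1..r. comp_form i y z *\<^sub>R X i) =
        (\<Sum>i=1..r. (1 / coeff i * wedge11 (weight i) (weight i \<circ> J) y z) *\<^sub>R X i)"
      by (rule sum.cong[OF refl]) (simp only: comp_form_eq)
    finally show ?thesis .
  qed
  have br_JX_X_0: "br (J (X i)) (X j) = 0" if "i \<in> {1..m}" "j \<in> {1..m}" "i \<noteq> j \<or> r < i" for i j
  proof (cases "i = j")
    case True
    then have "j \<in> {r+1..m}" using that by auto
    then show ?thesis by (rule br_X_0)
  qed (rule mult_X[OF that(1,2)])
  have br_0: "br y (X i) = 0" "br y (J (X i)) = 0" if "i \<in> {r+1..m}" for i y
    using br_X_0[OF that] by (simp_all add: br_JX)
  have br_JX_JX: "br (J (X i)) (J (X j)) = 0" if "i \<in> {1..m}" "j \<in> {1..m}" for i j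
    using that by (simp only: br_J_J br_G_G X_in_G)
  have "brackets_given_by br J m X r coeff weight comp_form"
    unfolding brackets_given_by_def
    by (intro conjI ballI impI)
      ((rule br_UU) | (rule br_JX_JX br_JX_X_0 br_0; assumption)
        | (simp only: br_eq_weight br_JX br_J_J br_G_G X_in_G coeff_def scaleR_minus_left))+
  moreover have "two_form_on U (comp_form j)" "type_11_on U J (comp_form j)" for j
    by (auto simp: two_form_on_def type_11_on_def bilinear_on_def linear_on_def comp_form_J)
      (simp_all add: comp_form_def br_simps inner_add_left)
  moreover have "linear_on U (weight i)" for i
    by (simp add: linear_on_def weight_simps)
  ultimately show ?thesis
    unfolding SKT_data_def
    using assms pluriclosed_iff_U Lambda2_image_eq orthonormal span_X r_le_m coeff_neq_0 by blast
qed

end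

text \<open>A maximal independent set \<open>B\<close> of axes is orthonormal, and its orthogonal
  complement in \<open>G\<close> is central. An orthonormal basis \<open>C\<close> of that
  complement completes the frame.\<close>

lemma (in abelian_skt) diagonal_frame_exists:
  obtains X r where "diagonal_frame br J X (dim G) r"
proof -
  obtain B where B: "B \<subseteq> axes" "independent B" "axes \<subseteq> span B"
    by (rule maximal_independent_subset)
  have finB: "finite B" using B(2) by (rule finiteI_independent)
  have BG: "B \<subseteq> G" and normB: "\<And>b. b \<in> B \<Longrightarrow> b \<bullet> b = 1"
    using B(1) by (auto simp: axes_def dot_square_norm)
  \<comment> \<open>Independence keeps \<open>y\<close> off the line of \<open>x\<close>, which is
    what \<open>axes_orthogonal\<close> asks for.\<close>
  have orthB: "x \<bullet> y = 0" if "x \<in> B" "y \<in> B" "x \<noteq> y" for x y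
  proof (rule axes_orthogonal)
    have "x \<in> span (B - {y})" using that by (intro span_base) simp
    then have "range (\<lambda>t. t *\<^sub>R x) \<subseteq> span (B - {y})" by (auto intro: span_scale)
    moreover have "y \<notin> span (B - {y})" using B(2) that by (auto simp: dependent_def)
    ultimately show "y \<notin> range (\<lambda>t. t *\<^sub>R x)" by blast
  qed (use B(1) that in auto)
  define W where "W = G \<inter> {A. \<forall>b\<in>B. b \<bullet> A = 0}"
  have "subspace {A. \<forall>b\<in>B. b \<bullet> A = 0}" by (auto simp: subspace_def inner_add_right)
  then have "subspace W" unfolding W_def by (intro subspace_inter subspace_G)
  then obtain C where C: "C \<subseteq> W" "pairwise orthogonal C" "\<And>x. x \<in> C \<Longrightarrow> norm x = 1"
      "independent C" "span C = W"
    by (rule orthonormal_basis_subspace) blast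
  have finC: "finite C" using C(4) by (rule finiteI_independent)
  have central: "br x A = 0" if "A \<in> W" for x A
  proof (rule br_orthogonal_to_axes)
    show "A \<in> G" using that by (simp add: W_def)
    have "\<And>b. b \<in> B \<Longrightarrow> orthogonal A b" using that by (simp add: W_def orthogonal_def inner_commute)
    then show "b \<bullet> A = 0" if "b \<in> axes" for b
      using orthogonal_to_span[of b B A] B(3) that by (auto simp: orthogonal_def inner_commute)
  qed
  have on: "x \<bullet> y = (if x = y then 1 else 0)" if "x \<in> B \<union> C" "y \<in> B \<union> C" for x y
  proof -
    have "b \<bullet> c = 0 \<and> c \<bullet> b = 0" if "b \<in> B" "c \<in> C" for b c
      using that C(1) by (auto simp: W_def inner_commute)
    moreover have "c \<bullet> d = (if c = d then 1 else 0)" if "c \<in> C" "d \<in> C" for c d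
      using that C(2,3) by (auto simp: pairwise_def orthogonal_def dot_square_norm)
    ultimately show ?thesis
      using that normB orthB by (metis Un_iff zero_neq_one)
  qed
  have disj: "B \<inter> C = {}"
  proof -
    have "b \<bullet> b = 0" if "b \<in> B" "b \<in> C" for b using that C(1) unfolding W_def by blast
    then show ?thesis using normB by force
  qed
  have span: "span (B \<union> C) = G"
  proof
    show "span (B \<union> C) \<subseteq> G"
      using BG C(1) by (intro span_minimal subspace_G) (auto simp: W_def)
    show "G \<subseteq> span (B \<union> C)"
    proof
      fix A assume A: "A \<in> G"
      define P where "P = (\<Sum>b\<in>B. (A \<bullet> b) *\<^sub>R b)"
      have "b \<bullet> P = A \<bullet> b" if "b \<in> B" for b
      proof -
        have "b \<bullet> P = (\<Sum>c\<in>B. if b = c then A \<bullet> c else 0)"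
          unfolding P_def inner_sum_right using that on by (intro sum.cong) auto
        then show ?thesis using that finB by simp
      qed
      moreover have "P \<in> G"
        unfolding P_def using BG by (intro subspace_sum subspace_G subspace_scale) auto
      ultimately have "A - P \<in> span C"
        using A unfolding C(5) W_def by (auto simp: inner_diff_right inner_commute subspace_G subspace_diff)
      moreover have "P \<in> span B" unfolding P_def by (intro span_sum span_scale span_base)
      ultimately have "(A - P) + P \<in> span (B \<union> C)"
        by (meson span_add span_mono subsetD sup_ge1 sup_ge2)
      then show "A \<in> span (B \<union> C)" by simp
    qed
  qed
  have "0 \<notin> B \<union> C" using on by fastforce
  moreover have "pairwise orthogonal (B \<union> C)" using on by (auto simp: pairwise_def orthogonal_def)
  ultimately have "independent (B \<union> C)" by (intro pairwise_orthogonal_independent)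
  then have dimG: "dim G = card B + card C"
    using span disj finB finC by (metis dim_span_eq_card_independent card_Un_disjoint)
  define r where "r = card B"
  obtain f where f: "bij_betw f {1..r} B"
    using finite_same_card_bij[of "{1..r}" B] finB by (auto simp: r_def)
  obtain g where g: "bij_betw g {r+1..dim G} C"
    using finite_same_card_bij[of "{r+1..dim G}" C] finC by (auto simp: r_def dimG)
  define X where "X i = (if i \<le> r then f i else g i)" for i
  have XB: "bij_betw X {1..r} B"
    using f by (rule bij_betw_cong[THEN iffD1, rotated]) (simp add: X_def)
  have XC: "bij_betw X {r+1..dim G} C"
    using g by (rule bij_betw_cong[THEN iffD1, rotated]) (simp add: X_def)
  have "{1..r} \<union> {r+1..dim G} = {1..dim G}" by (auto simp: r_def dimG)
  then have XD: "bij_betw X {1..dim G} (B \<union> C)"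
    using bij_betw_combine[OF XB XC disj] by simp
  have X1: "X i \<in> B" if "i \<in> {1..r}" for i using XB that by (rule bij_betwE[rule_format])
  have X2: "X i \<in> C" if "i \<in> {r+1..dim G}" for i using XC that by (rule bij_betwE[rule_format])
  have X3: "X i \<in> B \<union> C" if "i \<in> {1..dim G}" for i using XD that by (rule bij_betwE[rule_format])
  have axis: "X i \<in> axes" if "i \<in> {1..r}" for i using X1[OF that] B(1) by blast
  have orth: "X i \<bullet> X j = (if i = j then 1 else 0)" if "i \<in> {1..dim G}" "j \<in> {1..dim G}" for i j
    using on[OF X3 X3, OF that] inj_on_eq_iff[OF bij_betw_imp_inj_on[OF XD] that] by simp
  have zero: "br v (X i) = 0" if "i \<in> {r+1..dim G}" for v i
    using central[of "X i" v] X2[OF that] C(1) by blast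
  have "diagonal_frame br J X (dim G) r"
  proof
    show "span (X ` {1..dim G}) = G" using span bij_betw_imp_surj_on[OF XD] by simp
    show "r \<le> dim G" by (simp add: r_def dimG)
    show "br v (X i) = (br v (X i) \<bullet> X i) *\<^sub>R X i" if "i \<in> {1..r}" for v i
      by (rule br_axis[OF axis[OF that]])
    show "br (J (X i)) (X i) \<bullet> X i \<noteq> 0" if "i \<in> {1..r}" for i
      by (rule axis_coefficient_neq_0[OF axis[OF that]])
    show "br (J (X i)) (X j) = 0" if ij: "i \<in> {1..dim G}" "j \<in> {1..dim G}" "i \<noteq> j" for i j
    proof (cases "i \<le> r")
      case True
      then have "i \<in> {1..r}" using ij by simp
      moreover have "X j \<in> G" using X3[OF ij(2)] BG C(1) by (auto simp: W_def)
      ultimately show ?thesis using axis_mult[OF axis, of i "X j"] orth[OF ij(1,2)] ij(3) by simp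
    next
      case False
      then have "i \<in> {r+1..dim G}" using ij by simp
      then show ?thesis using zero mult_commute[of "X i" "X j"] by simp
    qed
  qed (rule orth zero; assumption)+
  then show thesis by (rule that)
qed

section \<open>From the normal form back to the SKT condition\<close>

context two_step_hermitian
begin

text \<open>Invariance under \<open>J\<close> and diagonality are checked on the \<open>X i\<close>,
  the \<open>J (X i)\<close> and \<open>U\<close>, where the brackets are prescribed, and then
  extended by linearity.\<close>

lemma diagonal_frame_if_SKT_data:
  assumes "SKT_data br J m X r lam \<mu> \<nu>"
  shows "diagonal_frame br J X m r"
proof -
  have orth: "\<And>i j. i \<in> {1..m} \<Longrightarrow> j \<in> {1..m} \<Longrightarrow> X i \<bullet> X j = (if i = j then 1 else 0)"
    and span_X: "span (X ` {1..m}) = G" and r_le: "r \<le> m"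
    and lam: "\<And>i. i \<in> {1..r} \<Longrightarrow> lam i \<noteq> 0"
    and lin_\<mu>: "\<And>i. i \<in> {1..r} \<Longrightarrow> linear_on U (\<mu> i)"
    and type11: "\<And>j y z. j \<in> {r+1..m} \<Longrightarrow> y \<in> U \<Longrightarrow> z \<in> U \<Longrightarrow> \<nu> j (J y) (J z) = \<nu> j y z"
    and br: "brackets_given_by br J m X r lam \<mu> \<nu>"
    using assms unfolding SKT_data_def type_11_on_def by blast+
  note br = br[unfolded brackets_given_by_def]
  note rest = br[THEN conjunct2, THEN conjunct2, THEN conjunct2, THEN conjunct2]
  have br_JX_X: "br (J (X i)) (X i) = lam i *\<^sub>R X i" if "i \<in> {1..r}" for i
    using br[THEN conjunct1] that by (rule bspec)
  have br_X_X: "br (X i) (X j) = 0" "br (J (X i)) (J (X j)) = 0"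
    if "i \<in> {1..m}" "j \<in> {1..m}" for i j
    using rest[THEN conjunct1] rest[THEN conjunct2, THEN conjunct1] that by simp_all
  have br_JX_0: "br (J (X i)) (X j) = 0" if "i \<in> {1..m}" "j \<in> {1..m}" "i \<noteq> j \<or> r < i" for i j
    using rest[THEN conjunct2, THEN conjunct2, THEN conjunct1] that by (simp only:)
  \<comment> \<open>Extension by zero to the indices above \<open>r\<close>, so that one formula
    covers the acting and the central basis vectors.\<close>
  define \<mu>' where "\<mu>' i = (if i \<le> r then \<mu> i else (\<lambda>_. 0))" for i
  have br_u_X: "br u (X i) = \<mu>' i u *\<^sub>R X i" "br u (J (X i)) = - \<mu>' i (J u) *\<^sub>R X i"
    if "i \<in> {1..m}" "u \<in> U" for i u
  proof -
    have "br u (X i) = \<mu>' i u *\<^sub>R X i \<and> br u (J (X i)) = - \<mu>' i (J u) *\<^sub>R X i"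
    proof (cases "i \<le> r")
      case True
      then have "i \<in> {1..r}" using that by simp
      then show ?thesis
        using br[THEN conjunct2, THEN conjunct1] br[THEN conjunct2, THEN conjunct2, THEN conjunct1]
          that True
        by (simp add: \<mu>'_def)
    next
      case False
      then have "i \<in> {r+1..m}" using that by simp
      then show ?thesis
        using rest[THEN conjunct2, THEN conjunct2, THEN conjunct2] that False by (simp add: \<mu>'_def)
    qed
    then show "br u (X i) = \<mu>' i u *\<^sub>R X i" "br u (J (X i)) = - \<mu>' i (J u) *\<^sub>R X i"
      by blast+
  qed
  have \<mu>_neg: "\<mu> i (- u) = - \<mu> i u" if "i \<in> {1..r}" "u \<in> U" for i u
    using lin_\<mu>[OF that(1)] that(2) unfolding linear_on_def by (metis scaleR_minus1_left mult_minus1)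
  then have \<mu>'_neg: "\<mu>' i (- u) = - \<mu>' i u" if "i \<in> {1..m}" "u \<in> U" for i u
    using that by (simp add: \<mu>'_def)
  have br_u_u: "br y z = (\<Sum>i=1..r. (1 / lam i * wedge11 (\<mu> i) (\<mu> i \<circ> J) y z) *\<^sub>R X i)
               + (\<Sum>j=r+1..m. \<nu> j y z *\<^sub>R X j)" if "y \<in> U" "z \<in> U" for y z
    using br[THEN conjunct2, THEN conjunct2, THEN conjunct2, THEN conjunct1] that by blast
  define gens where "gens = X ` {1..m} \<union> J ` X ` {1..m} \<union> U"
  have gens: "v \<in> span gens" for v unfolding gens_def by (rule mem_span_G_J_U[OF span_X])
  define P where "P x y \<longleftrightarrow> br (J x) (J y) = br x y" for x y
  have P_sym: "P x y \<Longrightarrow> P y x" for x y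
    using br_skew[of x y] br_skew[of "J x" "J y"] by (simp add: P_def)
  have P_XX: "P (X i) (X j)" "P (J (X i)) (J (X j))" if "i \<in> {1..m}" "j \<in> {1..m}" for i j
    using br_X_X[OF that] by (simp_all add: P_def br_simps)
  have P_XJ: "P (X i) (J (X j))" if "i \<in> {1..m}" "j \<in> {1..m}" for i j
  proof -
    have "br (J (X i)) (X j) = br (J (X j)) (X i)"
      using br_JX_0[OF that] br_JX_0[OF that(2,1)] by (cases "i = j") auto
    then show ?thesis using br_skew[of "X i" "J (X j)"] by (simp add: P_def br_simps)
  qed
  have P_UX: "P u (X i)" "P u (J (X i))" if "i \<in> {1..m}" "u \<in> U" for i u
    using br_u_X[OF that] br_u_X[OF that(1) J_U[OF that(2)]] \<mu>'_neg[OF that]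
    by (simp_all add: P_def br_simps)
  have P_UU: "P y z" if "y \<in> U" "z \<in> U" for y z
  proof -
    \<comment> \<open>Composition with \<open>J\<close> exchanges the two factors and changes one
      sign, which leaves the wedge unchanged. The remaining components are invariant by their type
      (1,1).\<close>
    have "wedge11 (\<mu> i) (\<mu> i \<circ> J) (J y) (J z) = wedge11 (\<mu> i) (\<mu> i \<circ> J) y z"
      if "i \<in> {1..r}" for i
      using \<mu>_neg[OF that \<open>y \<in> U\<close>] \<mu>_neg[OF that \<open>z \<in> U\<close>] by (simp add: wedge11_def)
    then show ?thesis
      unfolding P_def br_u_u[OF that] br_u_u[OF J_U[OF that(1)] J_U[OF that(2)]]
      using type11 that by (intro arg_cong2[of _ _ _ _ "(+)"] sum.cong) simp_all
  qed
  have "P x y" if "x \<in> gens" "y \<in> gens" for x y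
    using that unfolding gens_def
    by (elim UnE imageE) (auto simp only: intro: P_XX P_XJ P_UX P_UU P_sym[OF P_XJ] P_sym[OF P_UX(1)] P_sym[OF P_UX(2)])
  moreover have "bilinear (\<lambda>x y. br (J x) (J y))"
    unfolding bilinear_def by (auto intro!: linearI simp: br_simps J_simps)
  ultimately have ab: "br (J x) (J y) = br x y" for x y
    using bilinear_eq[of "\<lambda>x y. br (J x) (J y)" br UNIV gens UNIV gens x y] bilinear_br gens
    by (auto simp: P_def)
  have gens_X: "\<exists>c. br v (X i) = c *\<^sub>R X i \<and> (r < i \<longrightarrow> c = 0)" if i: "i \<in> {1..m}" and v: "v \<in> gens" for v i
    using v unfolding gens_def
  proof (elim UnE imageE)
    fix j assume "v = X j" "j \<in> {1..m}"
    then show ?thesis using br_X_X(1)[of j i] i by (intro exI[of _ 0]) simp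
  next
    fix w j assume v: "v = J w" "w = X j" and j: "j \<in> {1..m}"
    show ?thesis
    proof (cases "j = i \<and> j \<le> r")
      case True
      then show ?thesis using br_JX_X[of i] i v by (intro exI[of _ "lam i"]) simp
    next
      case False
      then have "j \<noteq> i \<or> r < j" by auto
      then show ?thesis using br_JX_0[OF j i] v by (intro exI[of _ 0]) simp
    qed
  next
    assume "v \<in> U"
    then show ?thesis using br_u_X(1)[OF i] by (intro exI[of _ "\<mu>' i v"]) (simp add: \<mu>'_def)
  qed
  show ?thesis
  proof
    show "br v (X i) = 0" if i: "i \<in> {r+1..m}" for v i
    proof -
      have "i \<in> {1..m}" "r < i" using i by auto
      then have "br w (X i) = 0" if "w \<in> gens" for w using gens_X[of i w] that by auto
      then show ?thesis using linear_eq_0_on_span[OF linear_br_left _ gens] by blast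
    qed
    show "br v (X i) = (br v (X i) \<bullet> X i) *\<^sub>R X i" if i: "i \<in> {1..r}" for v i
    proof -
      have im: "i \<in> {1..m}" using i r_le by auto
      define f where "f v = br v (X i) - (br v (X i) \<bullet> X i) *\<^sub>R X i" for v
      have "linear f" by (auto intro!: linearI simp: f_def br_simps inner_add_left algebra_simps)
      moreover have "f w = 0" if "w \<in> gens" for w
        using gens_X[OF im that] orth[OF im im] by (auto simp: f_def)
      ultimately have "f v = 0" using linear_eq_0_on_span[OF _ _ gens] by blast
      then show ?thesis by (simp add: f_def)
    qed
    show "br (J (X i)) (X i) \<bullet> X i \<noteq> 0" if i: "i \<in> {1..r}" for i
    proof -
      have "i \<in> {1..m}" using i r_le by auto
      then show ?thesis using br_JX_X[OF i] orth[of i i] lam[OF i] by simp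
    qed
    show "br (J (X i)) (X j) = 0" if "i \<in> {1..m}" "j \<in> {1..m}" "i \<noteq> j" for i j
      using br_JX_0 that by blast
  qed (use ab orth span_X r_le in blast)+
qed

text \<open>Since the \<open>X j\<close> are orthonormal, \<open>comp_form j\<close> agrees with
  \<open>\<nu> j\<close> on \<open>U\<close> for \<open>j\<close> above \<open>r\<close>, and
  \<open>pluriclosed_iff_U\<close> applies.\<close>

lemma pluriclosed_if_SKT_data:
  assumes "SKT_data br J m X r lam \<mu> \<nu>"
  shows "\<forall>w x y z. br w x \<bullet> br y z - br w y \<bullet> br x z + br w z \<bullet> br x y = 0"
proof -
  interpret diagonal_frame br J X m r by (rule diagonal_frame_if_SKT_data[OF assms])
  have "comp_form j y z = \<nu> j y z" if j: "j \<in> {r+1..m}" and yz: "y \<in> U" "z \<in> U" for j y z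
  proof -
    have ip: "X i \<bullet> X j = (if i = j then 1 else 0)" if "i \<in> {1..r} \<union> {r+1..m}" for i
      using orthonormal[OF _ index_le(2)[OF j], of i] index_le[of i] that by blast
    have "br y z = (\<Sum>i=1..r. (1 / lam i * wedge11 (\<mu> i) (\<mu> i \<circ> J) y z) *\<^sub>R X i)
               + (\<Sum>j=r+1..m. \<nu> j y z *\<^sub>R X j)"
      using assms yz unfolding SKT_data_def brackets_given_by_def by blast
    moreover have "(\<Sum>i=1..r. (1 / lam i * wedge11 (\<mu> i) (\<mu> i \<circ> J) y z) *\<^sub>R X i) \<bullet> X j = 0"
      unfolding inner_sum_left using ip j by (intro sum.neutral ballI) auto
    moreover have "(\<Sum>k=r+1..m. \<nu> k y z *\<^sub>R X k) \<bullet> X j = (\<Sum>k=r+1..m. if k = j then \<nu> k y z else 0)"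
      unfolding inner_sum_left using ip by (intro sum.cong) auto
    ultimately show ?thesis using j by (simp add: comp_form_def inner_add_left)
  qed
  then have "wedge22 (comp_form j) (comp_form j) w x y z = wedge22 (\<nu> j) (\<nu> j) w x y z"
    if "j \<in> {r+1..m}" "w \<in> U" "x \<in> U" "y \<in> U" "z \<in> U" for j w x y z
    using that by (simp only: wedge22_def)
  then have "(\<Sum>j=r+1..m. wedge22 (comp_form j) (comp_form j) w x y z) =
      (\<Sum>j=r+1..m. wedge22 (\<nu> j) (\<nu> j) w x y z)"
    if "w \<in> U" "x \<in> U" "y \<in> U" "z \<in> U" for w x y z
    using that by (intro sum.cong) blast+
  moreover have "(\<Sum>j=r+1..m. wedge22 (\<nu> j) (\<nu> j) w x y z) = 0"
    if "w \<in> U" "x \<in> U" "y \<in> U" "z \<in> U" for w x y z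
    using assms that unfolding SKT_data_def by blast
  ultimately show ?thesis unfolding pluriclosed_iff_U by simp
qed

end

theorem theorem5p5:
  fixes br :: "'a::euclidean_space \<Rightarrow> 'a \<Rightarrow> 'a"
    and J :: "'a \<Rightarrow> 'a"
    and n m :: nat
  assumes "almost_hermitian br J"
    and "DIM('a) = 2 * n"
    and "two_step_solvable UNIV br"
    and "dim (commutator UNIV br) = m"
    and "commutator UNIV br \<inter> J ` commutator UNIV br = {0}"
  shows "(SKT br J \<longleftrightarrow> (\<exists>X r lam \<mu> \<nu>. SKT_data br J m X r lam \<mu> \<nu>)) \<and>
         (\<forall>X r lam \<mu> \<nu>. SKT_data br J m X r lam \<mu> \<nu> \<longrightarrow>
            (\<exists>(H :: 'a set) h. lie_algebra H h \<and> nilpotent_lie H h \<and> dim H = 2 * (n - r) \<and>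
               lie_isomorphic UNIV br
                 (copies_carrier r UNIV \<times> H) (sum_bracket (copies_bracket aff_bracket) h)))"
proof -
  interpret two_step_hermitian br J by unfold_locales (rule assms(1,3))+
  have SKT_iff': "SKT br J \<longleftrightarrow> (\<forall>x y. br (J x) (J y) = br x y) \<and>
    (\<forall>w x y z. br w x \<bullet> br y z - br w y \<bullet> br x z + br w z \<bullet> br x y = 0)"
    by (rule SKT_iff[OF assms(5)])
  have "\<exists>X r lam \<mu> \<nu>. SKT_data br J m X r lam \<mu> \<nu>" if "SKT br J"
  proof -
    interpret abelian_skt br J
      using that SKT_iff' by unfold_locales blast+
    obtain X r where "diagonal_frame br J X (dim G) r" by (rule diagonal_frame_exists)
    then interpret diagonal_frame br J X m r by (simp only: assms(4))
    show ?thesis using SKT_data_if_pluriclosed pluriclosed by blast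
  qed
  moreover have "SKT br J" if "SKT_data br J m X r lam \<mu> \<nu>" for X r lam \<mu> \<nu>
  proof -
    interpret diagonal_frame br J X m r by (rule diagonal_frame_if_SKT_data[OF that])
    show ?thesis using pluriclosed_if_SKT_data[OF that] SKT_iff' br_J_J by blast
  qed
  moreover have "\<exists>(H :: 'a set) h. lie_algebra H h \<and> nilpotent_lie H h \<and> dim H = 2 * (n - r) \<and>
      lie_isomorphic UNIV br
        (copies_carrier r UNIV \<times> H) (sum_bracket (copies_bracket aff_bracket) h)"
    if "SKT_data br J m X r lam \<mu> \<nu>" for X r lam \<mu> \<nu>
  proof -
    interpret diagonal_frame br J X m r by (rule diagonal_frame_if_SKT_data[OF that])
    \<comment> \<open>From \<open>dim kernel + 2 * r = 2 * n\<close> it follows that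
      \<open>r\<close> is at most \<open>n\<close>, so the natural-number subtraction is
      exact.\<close>
    have "dim kernel = 2 * (n - r)" using dim_kernel[OF assms(5)] assms(2) by simp
    then show ?thesis
      using lie_algebra_kernel nilpotent_kernel lie_isomorphic_affine_sum by blast
  qed
  ultimately show ?thesis by blast
qed

end
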